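(* Let $n$ be an even nonnegative integer, and let $\ell$ be the length of the longest string of consecutive $1$'s in the binary expansion of $n$. Then $\operatorname{TC}_k(P^n)=kn$ for all $k\ge 2^{\ell+1}-1$.
   Context: $P^n$ denotes $n$-dimensional real projective space. For a path-connected space $X$ and an integer $k\ge2$, $\operatorname{TC}_k(X)$ is the (reduced) higher topological complexity of $X$ in the sense of Rudyak: the smallest integer $m\ge0$ such that $X^k$ can be covered by $m+1$ open sets, on each of which the evaluation fibration $X^{[0,1]}\to X^k$, $\gamma\mapsto\bigl(\gamma(0),\gamma(\tfrac1{k-1}),\ldots,\gamma(\tfrac{k-2}{k-1}),\gamma(1)\bigr)$, admits a continuous section. Only $k\ge2$ is considered. *)

theory Defs
  imports "HOL-Analysis.Analysis" "HOL-Library.Extended_Nat"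
begin

definition quotient_topology :: "'a topology \<Rightarrow> ('a \<Rightarrow> 'b) \<Rightarrow> 'b topology" where
  "quotient_topology X q =
     topology (\<lambda>U. U \<subseteq> q ` topspace X \<and> openin X {x \<in> topspace X. q x \<in> U})"

lemma openin_quotient_topology:
  "openin (quotient_topology X q) U \<longleftrightarrow>
     U \<subseteq> q ` topspace X \<and> openin X {x \<in> topspace X. q x \<in> U}"
proof -
  let ?P = "\<lambda>U. U \<subseteq> q ` topspace X \<and> openin X {x \<in> topspace X. q x \<in> U}"
  have "?P (S \<inter> T)" if "?P S" "?P T" for S T
  proof -
    have "{x \<in> topspace X. q x \<in> S \<inter> T} =
        {x \<in> topspace X. q x \<in> S} \<inter> {x \<in> topspace X. q x \<in> T}" by auto
    moreover have "openin X ({x \<in> topspace X. q x \<in> S} \<inter> {x \<in> topspace X. q x \<in> T})"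
      using that by (intro openin_Int) simp_all
    moreover have "S \<inter> T \<subseteq> q ` topspace X" using that by blast
    ultimately show ?thesis by metis
  qed
  moreover have "?P (\<Union>\<K>)" if "\<And>K. K \<in> \<K> \<Longrightarrow> ?P K" for \<K>
  proof -
    have "{x \<in> topspace X. q x \<in> \<Union>\<K>} = (\<Union>K\<in>\<K>. {x \<in> topspace X. q x \<in> K})" by auto
    moreover have "openin X (\<Union>K\<in>\<K>. {x \<in> topspace X. q x \<in> K})"
      using that by (intro openin_Union) auto
    moreover have "\<Union>\<K> \<subseteq> q ` topspace X" using that by blast
    ultimately show ?thesis by metis
  qed
  ultimately have "istopology ?P" unfolding istopology_def by simp
  then show ?thesis unfolding quotient_topology_def by (simp only: topology_inverse')
qed

lemma topspace_quotient_topology [simp]: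
  "topspace (quotient_topology X q) = q ` topspace X"
proof (rule antisym)
  show "topspace (quotient_topology X q) \<subseteq> q ` topspace X"
    using openin_topspace[of "quotient_topology X q"] by (simp only: openin_quotient_topology)
  have "{x \<in> topspace X. q x \<in> q ` topspace X} = topspace X" by auto
  then have "openin (quotient_topology X q) (q ` topspace X)"
    by (simp add: openin_quotient_topology)
  then show "q ` topspace X \<subseteq> topspace (quotient_topology X q)"
    by (rule openin_subset)
qed

lemma quotient_map_quotient_topology: "quotient_map X (quotient_topology X q) q"
  unfolding quotient_map_def by (auto simp: openin_quotient_topology)

definition antipodal_class :: "(nat \<Rightarrow> real) \<Rightarrow> (nat \<Rightarrow> real) set" where
  "antipodal_class x = {x, \<lambda>i. - x i}"

definition real_projective_space :: "nat \<Rightarrow> (nat \<Rightarrow> real) set topology" where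
  "real_projective_space n = quotient_topology (nsphere n) antipodal_class"

text \<open>A path is represented by its extension by \<^term>\<open>undefined\<close> outside the unit interval,
  so that distinct elements of the path space differ as maps on the interval.\<close>

definition paths :: "'a topology \<Rightarrow> (real \<Rightarrow> 'a) set" where
  "paths X = {\<gamma>. pathin X \<gamma> \<and> \<gamma> \<in> extensional {0..1}}"

text \<open>The compact-open topology on the set of paths, given by its usual subbasis.\<close>

definition path_space :: "'a topology \<Rightarrow> (real \<Rightarrow> 'a) topology" where
  "path_space X = topology_generated_by
     {{\<gamma> \<in> paths X. \<gamma> ` K \<subseteq> U} | K U. K \<subseteq> {0..1} \<and> compact K \<and> openin X U}"

lemma topspace_path_space [simp]: "topspace (path_space X) = paths X"
proof -
  let ?B = "{{\<gamma> \<in> paths X. \<gamma> ` K \<subseteq> U} | K U. K \<subseteq> {0..1} \<and> compact K \<and> openin X U}"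
  have "\<exists>K U. paths X = {\<gamma> \<in> paths X. \<gamma> ` K \<subseteq> U} \<and> K \<subseteq> {0..1} \<and> compact K \<and> openin X U"
    by (rule exI[of _ "{}"], rule exI[of _ "topspace X"]) simp
  then have "paths X \<in> ?B" by (rule CollectI)
  then have "paths X \<subseteq> \<Union>?B" by (rule Union_upper)
  moreover have "\<Union>?B \<subseteq> paths X" by (rule Union_least) auto
  ultimately show ?thesis
    unfolding path_space_def topology_generated_by_topspace by (intro antisym)
qed

definition power_space :: "nat \<Rightarrow> 'a topology \<Rightarrow> (nat \<Rightarrow> 'a) topology" where
  "power_space k X = product_topology (\<lambda>_. X) {..<k}"

definition path_eval :: "nat \<Rightarrow> (real \<Rightarrow> 'a) \<Rightarrow> nat \<Rightarrow> 'a" where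
  "path_eval k \<gamma> = (\<lambda>j\<in>{..<k}. \<gamma> (real j / (real k - 1)))"

definition admits_section :: "nat \<Rightarrow> 'a topology \<Rightarrow> (nat \<Rightarrow> 'a) set \<Rightarrow> bool" where
  "admits_section k X U \<longleftrightarrow>
     (\<exists>s. continuous_map (subtopology (power_space k X) U) (path_space X) s \<and>
          (\<forall>x\<in>U. path_eval k (s x) = x))"

text \<open>Reduced higher topological complexity, meaningful for \<open>k \<ge> 2\<close>;
  the infimum is \<open>\<infinity>\<close> when no finite cover exists.\<close>

definition TC :: "nat \<Rightarrow> 'a topology \<Rightarrow> enat" where
  "TC k X = Inf {enat m | m. \<exists>U :: nat \<Rightarrow> (nat \<Rightarrow> 'a) set.
     (\<forall>i\<le>m. openin (power_space k X) (U i) \<and> admits_section k X (U i)) \<and>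
     (\<Union>i\<le>m. U i) = topspace (power_space k X)}"

definition longest_ones :: "nat \<Rightarrow> nat" where
  "longest_ones n = Max {l. \<exists>j. \<forall>i<l. bit n (j + i)}"

lemma finite_ones_lengths: "finite {l. \<exists>j. \<forall>i<l. bit (n::nat) (j + i)}"
proof (rule finite_subset)
  show "{l. \<exists>j. \<forall>i<l. bit n (j + i)} \<subseteq> {..n}"
  proof clarify
    fix l j assume *: "\<forall>i<l. bit n (j + i)"
    show "l \<le> n"
    proof (rule ccontr)
      assume "\<not> l \<le> n"
      then have "bit n (j + n)" using * by simp
      moreover have "n < 2 ^ (j + n)"
        using less_exp[of "j + n"] by linarith
      ultimately show False by (simp add: bit_iff_odd)
    qed
  qed
qed simp

end

(* Lower bound. A section over an open set V of (P^n)^k assigns to tuples of unit vectors a sign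
   telling whether the lift of the section's path that starts at x_0 ends at x_j or at -x_j. So the
   mod 2 class w_0 + w_j vanishes on V for every j, w_i being the generator pulled back from the
   i-th factor. If kn such sets covered (P^n)^k, every product of kn classes w_0 + w_j would vanish.
   But taking n + b_j factors w_0 + w_j, where n is the sum of the b_j and each b_j has no binary
   digit in common with n, the coefficient of w_0^n ... w_{k-1}^n is the product of the odd numbers
   binomial(n + b_j, n). Such b_1, ..., b_{k-1} exist: a maximal run of r ones, starting at bit p of
   the even number n, is a sum of 2^(r+1) - 2 copies of 2^(p-1).
   Cohomology is replaced by explicit cochains: spherical coordinates present P^n as a cube with
   opposite facets identified, and the product is evaluated on a fine cubical grid.

   Upper bound. The products of Schubert cells of P^n, grouped by dimension, are separated by open
   sets on which the sections are written down in affine charts. *)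

theory Submission
  imports Defs "HOL-Library.Z2"
begin

section \<open>Decomposing a number into binary disjoint summands\<close>

unbundle bit_operations_syntax

text \<open>On the cube every class is exact: it is the coboundary of a function on the lattice
  points, which need not be continuous and only changes by a constant across each identification of
  facets. The contradiction plays local against global. The grid is so fine that each closed top
  cell lies in one of the open sets; there the corresponding sign is constant, so the product
  vanishes on that cell. But the sum of the product over all top cells depends only on the twists,
  by repeated summation by parts, and equals the required coefficient. The sum n of the b_j is
  forced by degrees: kn factors are shared among the k - 1 classes w_0 + w_j, and each of these must
  occur at least n times for w_j^n to appear, which leaves a surplus of n factors. In the upper
  bound, cells of equal dimension can be separated because their index vectors have equal sums: of
  two different ones, neither is nowhere smaller than the other.\<close>

lemma binomial_double_parity:
  fixes a b :: nat
  shows "odd ((2 * a) choose (2 * b)) \<longleftrightarrow> odd (a choose b)"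
    and "even ((2 * a) choose Suc (2 * b))"
proof (induction a arbitrary: b)
  case 0
  { case 1 show ?case by (cases b) auto }
  { case 2 show ?case by simp }
next
  case (Suc a)
  \<comment> \<open>Pascal's rule twice; the middle term is doubled and disappears modulo 2.\<close>
  have E: "Suc (Suc (2 * a)) choose Suc (Suc j) =
      (2 * a choose j) + 2 * (2 * a choose Suc j) + (2 * a choose Suc (Suc j))" for j
    by simp
  { case 1
    show ?case
    proof (cases b)
      case (Suc c)
      have "2 * Suc a choose (2 * b) = Suc (Suc (2 * a)) choose Suc (Suc (2 * c))"
        using Suc by simp
      then have "odd (2 * Suc a choose (2 * b)) \<longleftrightarrow>
          odd (2 * a choose (2 * c)) \<noteq> odd (2 * a choose (2 * Suc c))"
        unfolding E by simp
      then show ?thesis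
        unfolding Suc.IH(1) using Suc by simp
    qed simp }
  { case 2
    show ?case
    proof (cases b)
      case (Suc c)
      have "2 * Suc a choose Suc (2 * b) = Suc (Suc (2 * a)) choose Suc (Suc (Suc (2 * c)))"
        using Suc by simp
      then have "even (2 * Suc a choose Suc (2 * b)) \<longleftrightarrow>
          even (2 * a choose Suc (2 * c)) = even (2 * a choose Suc (2 * Suc c))"
        unfolding E by simp
      then show ?thesis
        unfolding eqTrueI[OF Suc.IH(2)] by simp
    qed simp }
qed

text \<open>Kummer's theorem modulo 2: the addition \<open>n + b\<close> produces no carry. The
  induction strips the last binary digit, where at most one of \<open>n\<close> and \<open>b\<close>
  has a one.\<close>

lemma odd_binomial_of_disjoint:
  fixes n b :: nat
  assumes "n AND b = 0"
  shows "odd ((n + b) choose n)"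
  using assms
proof (induction n arbitrary: b rule: less_induct)
  case (less n)
  show ?case
  proof (cases "n = 0")
    case False
    define n' b' where "n' = n div 2" and "b' = b div 2"
    have d: "n' AND b' = 0"
      using less.prems and_rec[of n b] by (simp add: n'_def b'_def)
    have IH: "odd ((n' + b') choose n')"
      using less.IH[of n' b'] False d by (simp add: n'_def)
    have ne: "\<not> (odd n \<and> odd b)"
      using less.prems even_and_iff[of n b] by simp
    consider "even n" "even b" | "odd n" "even b" | "even n" "odd b" using ne by blast
    then show ?thesis
    proof cases
      case 1
      then have "n = 2 * n'" "n + b = 2 * (n' + b')" by (auto simp: n'_def b'_def)
      then show ?thesis using IH binomial_double_parity(1)[of "n' + b'" n'] by simp
    next
      case 2
      then have e: "n = Suc (2 * n')" "n + b = Suc (2 * (n' + b'))" by (auto simp: n'_def b'_def)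
      show ?thesis unfolding e(2) unfolding e(1) binomial_Suc_Suc
        using IH binomial_double_parity[of "n' + b'" n'] by auto
    next
      case 3
      then have e: "n = 2 * n'" "n + b = Suc (2 * (n' + b'))" by (auto simp: n'_def b'_def)
      show ?thesis
      proof (cases n')
        case (Suc c)
        have *: "even (2 * (n' + b') choose Suc (2 * c))" by (rule binomial_double_parity(2))
        have "odd (2 * (n' + b') choose (2 * n'))" using IH binomial_double_parity(1) by blast
        then have **: "odd (2 * (n' + b') choose Suc (Suc (2 * c)))" by (simp add: Suc)
        have "n = Suc (Suc (2 * c))" using e Suc by simp
        then show ?thesis unfolding e(2) using * ** by (simp add: even_add)
      qed (use e in simp)
    qed
  qed simp
qed

text \<open>Marks the places directly above which \<open>e + 1\<close> consecutive ones of
  \<open>n\<close> stand. The shift by one leaves room for summands located just below a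
  run.\<close>

primrec ones_above :: "nat \<Rightarrow> nat \<Rightarrow> nat" where
  "ones_above n 0 = n div 2"
| "ones_above n (Suc e) = (ones_above n e AND n) div 2"

lemma bit_ones_above: "bit (ones_above n e) p \<longleftrightarrow> (\<forall>i\<le>e. bit n (p + Suc i))"
proof (induction e arbitrary: p)
  case 0
  show ?case by (simp flip: bit_Suc)
next
  case (Suc e)
  have "bit (ones_above n (Suc e)) p \<longleftrightarrow> bit n (Suc p) \<and> (\<forall>i\<le>e. bit n (p + Suc (Suc i)))"
    by (auto simp: bit_and_iff Suc simp flip: bit_Suc)
  also have "\<dots> \<longleftrightarrow> (\<forall>i<Suc (Suc e). bit n (p + Suc i))"
    unfolding All_less_Suc2[of "Suc e"] by (simp add: less_Suc_eq_le)
  also have "\<dots> \<longleftrightarrow> (\<forall>i\<le>Suc e. bit n (p + Suc i))" by (simp add: less_Suc_eq_le)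
  finally show ?case .
qed

text \<open>A surviving bit would lie below a run longer than the longest one.\<close>

lemma ones_above_longest: "ones_above n (longest_ones n) = 0"
proof (rule ccontr)
  let ?L = "{l. \<exists>j. \<forall>i<l. bit n (j + i)}"
  assume "ones_above n (longest_ones n) \<noteq> 0"
  then obtain p where "bit (ones_above n (longest_ones n)) p"
    using bit_eq_iff[of "ones_above n (longest_ones n)" 0] by auto
  then have "\<forall>i<Suc (longest_ones n). bit n (Suc p + i)"
    by (simp add: bit_ones_above less_Suc_eq_le)
  then have "Suc (longest_ones n) \<in> ?L" by blast
  then have "Suc (longest_ones n) \<le> Max ?L"
    using finite_ones_lengths by (intro Max_ge)
  then show False by (simp add: longest_ones_def)
qed

text \<open>All runs are treated at once. A bit \<open>p\<close> of \<open>ones_above n e\<close>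
  stands for \<open>2 ^ Suc e\<close> copies of \<open>2 ^ p\<close> still to be placed. Where
  \<open>n\<close> has a zero at \<open>p\<close>, the copies are legitimate summands and join the
  list; where \<open>n\<close> has a one, the place moves down by one and the number of copies
  doubles. As \<open>n\<close> is even, no place is pushed below bit 0. The batches of 2, 4, 8, ...
  equal summands give the length.\<close>

lemma sum_of_disjoint_list:
  fixes n :: nat
  assumes "even n"
  shows "\<exists>xs. length xs = 2 ^ Suc e - 2 \<and> (\<forall>x\<in>set xs. n AND x = 0) \<and>
    n = 2 ^ Suc e * ones_above n e + sum_list xs"
proof (induction e)
  case 0
  show ?case using assms by (intro exI[of _ "[]"]) simp
next
  case (Suc e)
  then obtain xs where xs: "length xs = 2 ^ Suc e - 2" "\<forall>x\<in>set xs. n AND x = 0"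
    "n = 2 ^ Suc e * ones_above n e + sum_list xs" by blast
  define M where "M = ones_above n e"
  define D where "D = M XOR (M AND n)"
  have D: "n AND D = 0"
    by (rule bit_eqI) (auto simp: D_def bit_simps)
  have "(M AND n) AND D = 0"
    by (rule bit_eqI) (auto simp: D_def bit_simps)
  then have "(M AND n) + D = (M AND n) XOR D"
    by (rule disjunctive_add_eq_xor)
  also have "\<dots> = M"
    by (rule bit_eqI) (auto simp: D_def bit_simps)
  finally have "M = (M AND n) + D" by simp
  moreover have "even (M AND n)" using assms by (simp add: even_and_iff)
  then have "M AND n = 2 * ones_above n (Suc e)" by (simp add: M_def)
  ultimately have M: "M = D + 2 * ones_above n (Suc e)" by simp
  show ?case
  proof (intro exI[of _ "xs @ replicate (2 ^ Suc e) D"] conjI)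
    show "length (xs @ replicate (2 ^ Suc e) D) = 2 ^ Suc (Suc e) - 2"
      using xs(1) by simp
    show "\<forall>x\<in>set (xs @ replicate (2 ^ Suc e) D). n AND x = 0" using xs(2) D by auto
    have "2 ^ Suc e * M = 2 ^ Suc e * D + 2 ^ Suc (Suc e) * ones_above n (Suc e)"
      unfolding M by (simp only: distrib_left power_Suc mult.assoc mult.left_commute)
    then show "n = 2 ^ Suc (Suc e) * ones_above n (Suc e) + sum_list (xs @ replicate (2 ^ Suc e) D)"
      using xs(3) unfolding M_def[symmetric] sum_list_append sum_list_replicate of_nat_id by linarith
  qed
qed

lemma disjoint_decomposition:
  fixes n K :: nat
  assumes "even n" "K \<ge> 2 ^ (longest_ones n + 1) - 2"
  shows "\<exists>b. (\<Sum>j<K. b j) = n \<and> (\<forall>j<K. n AND b j = 0)"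
proof -
  obtain xs where "length xs = 2 ^ Suc (longest_ones n) - 2" "\<forall>x\<in>set xs. n AND x = 0"
    and "n = 2 ^ Suc (longest_ones n) * ones_above n (longest_ones n) + sum_list xs"
    using sum_of_disjoint_list[OF assms(1)] by blast
  then have xs: "length xs \<le> K" "\<forall>x\<in>set xs. n AND x = 0" "n = sum_list xs"
    using assms(2) by (simp_all only: ones_above_longest) simp_all
  \<comment> \<open>Padding by 0 is allowed, since 0 shares no binary digit with
    \<open>n\<close>.\<close>
  define b where "b j = (if j < length xs then xs ! j else 0)" for j
  have "(\<Sum>j<K. b j) = (\<Sum>j<length xs. xs ! j)"
    unfolding b_def using xs(1) by (intro sum.mono_neutral_cong_right) auto
  also have "\<dots> = n" using xs(3) by (simp add: sum_list_sum_nth atLeast0LessThan)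
  finally show ?thesis using xs(2) by (intro exI[of _ b]) (auto simp: b_def)
qed

unbundle no bit_operations_syntax

section \<open>Cup products of degree one classes on a cubical grid\<close>

declare add_bit_eq_xor [simp del] mult_bit_eq_and [simp del] minus_bit_def [simp del]

lemma bit_add_self [simp]: "x + x = (0::bit)" "x + (x + y) = (y::bit)"
  by (cases x; simp)+

text \<open>The coordinates of a block stand for the angles of a point on a sphere. Where angle
  \<open>p\<close> takes an extreme value, the later angles have no influence, and reversing the
  angles up to \<open>p\<close> produces the antipode.\<close>

definition reflect :: "nat \<Rightarrow> 'a::ab_group_add \<Rightarrow> nat \<Rightarrow> (nat \<Rightarrow> 'a) \<Rightarrow> nat \<Rightarrow> 'a" where
  "reflect n c p v = (\<lambda>j. if j div n = p div n \<and> j \<le> p then c - v j else v j)"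

text \<open>A lattice point is read as the centre of the cell spanned by its odd coordinates, and a
  function on lattice points as a family of cochains in all dimensions.\<close>

definition coboundary :: "nat \<Rightarrow> ((nat \<Rightarrow> int) \<Rightarrow> bit) \<Rightarrow> (nat \<Rightarrow> int) \<Rightarrow> bit" where
  "coboundary N g v =
     (\<Sum>p | p < N \<and> odd (v p). g (v(p := v p + 1)) + g (v(p := v p - 1)))"

text \<open>The product of the classes \<open>d (s 0), d (s 1), \<dots>\<close>: since the previous product \<open>A\<close> is a
  cocycle and \<open>s t\<close> a \<open>0\<close>-cochain, \<open>d (s t) \<union> A = d (s t * A)\<close>.\<close>

primrec cup :: "nat \<Rightarrow> (nat \<Rightarrow> (nat \<Rightarrow> int) \<Rightarrow> bit) \<Rightarrow> nat \<Rightarrow> (nat \<Rightarrow> int) \<Rightarrow> bit" where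
  "cup N s 0 = (\<lambda>v. 1)"
| "cup N s (Suc t) = coboundary N (\<lambda>u. s t u * cup N s t u)"

lemma of_nat_odd_bit: "odd x \<Longrightarrow> of_nat x = (1::bit)"
  by (elim oddE) simp

lemma sum_symmetric_bit:
  fixes h :: "'a \<Rightarrow> 'a \<Rightarrow> bit"
  assumes "finite A" and sym: "\<And>p q. p \<in> A \<Longrightarrow> q \<in> A \<Longrightarrow> h p q = h q p"
  shows "(\<Sum>p\<in>A. \<Sum>q\<in>A - {p}. h p q) = 0"
  using assms
proof (induction A rule: finite_induct)
  case (insert a A)
  have "(\<Sum>p\<in>insert a A. \<Sum>q\<in>insert a A - {p}. h p q) =
      (\<Sum>q\<in>A. h a q) + (\<Sum>p\<in>A. \<Sum>q\<in>insert a A - {p}. h p q)"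
    using insert.hyps by simp
  also have "(\<Sum>p\<in>A. \<Sum>q\<in>insert a A - {p}. h p q) = (\<Sum>p\<in>A. h p a + (\<Sum>q\<in>A - {p}. h p q))"
  proof (rule sum.cong[OF refl])
    fix p assume "p \<in> A"
    then have "insert a A - {p} = insert a (A - {p})" using insert.hyps by auto
    then show "(\<Sum>q\<in>insert a A - {p}. h p q) = h p a + (\<Sum>q\<in>A - {p}. h p q)"
      using insert.hyps by simp
  qed
  also have "\<dots> = (\<Sum>q\<in>A. h a q) + 0"
    using insert by (simp add: sum.distrib)
  finally show ?case by simp
qed simp

text \<open>Each face of codimension two is reached twice, once for each order of its two normal
  directions \<open>p\<close> and \<open>q\<close>.\<close>

lemma coboundary_coboundary: "coboundary N (coboundary N g) v = 0"
proof -
  define P where "P = {p. p < N \<and> odd (v p)}"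
  define h where "h p q = (\<Sum>a\<in>{1,-1}. \<Sum>b\<in>{1,-1}. g (v(p := v p + a, q := v q + b)))" for p q
  have P: "{q. q < N \<and> odd ((v(p := v p + a)) q)} = P - {p}" if "p \<in> P" "a \<in> {1,-1}" for p a
    using that by (auto simp: P_def split: if_splits)
  have *: "coboundary N g (v(p := v p + 1)) + coboundary N g (v(p := v p - 1)) = (\<Sum>q\<in>P - {p}. h p q)"
    if "p \<in> P" for p
  proof -
    have "coboundary N g (v(p := v p + a)) =
        (\<Sum>q\<in>P - {p}. \<Sum>b\<in>{1,-1}. g (v(p := v p + a, q := v q + b)))" if a: "a \<in> {1,-1}" for a
      unfolding coboundary_def P[OF \<open>p \<in> P\<close> a] by (intro sum.cong) auto
    from this[of 1] this[of "-1"] show ?thesis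
      by (simp add: h_def sum.distrib)
  qed
  have "coboundary N (coboundary N g) v = (\<Sum>p\<in>P. \<Sum>q\<in>P - {p}. h p q)"
    unfolding coboundary_def[of N "coboundary N g"] P_def[symmetric] using * by (intro sum.cong) auto
  also have "\<dots> = 0"
  proof -
    have "h p q = h q p" for p q
      by (cases "p = q") (auto simp: h_def fun_upd_twist)
    moreover have "finite P" by (simp add: P_def)
    ultimately show ?thesis by (intro sum_symmetric_bit) auto
  qed
  finally show ?thesis .
qed

lemma cup_cocycle: "coboundary N (cup N s t) v = 0"
proof (cases t)
  case 0
  then show ?thesis by (simp add: coboundary_def)
next
  case (Suc t')
  then show ?thesis by (simp add: coboundary_coboundary)
qed

lemma coboundary_cong:
  assumes "\<And>p a. p < N \<Longrightarrow> odd (v p) \<Longrightarrow> a \<in> {1,-1} \<Longrightarrow> f (v(p := v p + a)) = g (v(p := v p + a))"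
  shows "coboundary N f v = coboundary N g v"
  unfolding coboundary_def using assms[of _ 1] assms[of _ "-1"] by (intro sum.cong) auto

lemma coboundary_add: "coboundary N (\<lambda>u. f u + g u) v = coboundary N f v + coboundary N g v"
  unfolding coboundary_def by (simp add: sum.distrib algebra_simps)

lemma coboundary_scale: "coboundary N (\<lambda>u. c * g u) v = c * coboundary N g v"
  unfolding coboundary_def by (simp add: sum_distrib_left algebra_simps)

text \<open>In terms of cells: the cell centred at \<open>u\<close> lies in the closure of the cell
  centred at \<open>v\<close>.\<close>

definition face :: "nat \<Rightarrow> (nat \<Rightarrow> int) \<Rightarrow> (nat \<Rightarrow> int) \<Rightarrow> bool" where
  "face N u v \<longleftrightarrow> (\<forall>p. u p = v p \<or> p < N \<and> odd (v p) \<and> \<bar>u p - v p\<bar> = 1)"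

lemma face_step: "face N (u(p := u p + a)) v" if "face N u v" "p < N" "odd (u p)" "a \<in> {1,-1}"
  unfolding face_def
proof
  fix q
  have q: "u q = v q \<or> q < N \<and> odd (v q) \<and> \<bar>u q - v q\<bar> = 1" using that(1) by (simp add: face_def)
  show "(u(p := u p + a)) q = v q \<or> q < N \<and> odd (v q) \<and> \<bar>(u(p := u p + a)) q - v q\<bar> = 1"
  proof (cases "q = p")
    case True
    have "u p = v p"
    proof (rule ccontr)
      assume "u p \<noteq> v p"
      then have "odd (v p)" "u p = v p + 1 \<or> u p = v p - 1" using q True by auto
      then show False using that(3) by auto
    qed
    then show ?thesis using that True by auto
  qed (use q in simp)
qed

text \<open>A constant factor comes out of the coboundary and leaves the coboundary of a cocycle;
  all later products inherit the zero. Read backwards, a nonzero product on a cell shows that every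
  factor \<open>s t\<close> varies on its closure.\<close>

lemma cup_vanish:
  assumes const: "\<And>u. face N u v \<Longrightarrow> s t u = c" and "t < T" "face N u v"
  shows "cup N s T u = 0"
  using assms(2,3)
proof (induction T arbitrary: u)
  case (Suc T)
  show ?case
  proof (cases "t = T")
    case True
    have "cup N s (Suc T) u = coboundary N (\<lambda>u. c * cup N s T u) u"
      unfolding cup.simps using True const face_step[OF Suc.prems(2)]
      by (intro coboundary_cong) auto
    then show ?thesis by (simp add: coboundary_scale cup_cocycle)
  next
    case False
    then have "cup N s T (u(p := u p + a)) = 0" if "p < N" "odd (u p)" "a \<in> {1,-1}" for p a
      using Suc.IH face_step[OF Suc.prems(2) that] Suc.prems(1) by simp
    then have "cup N s (Suc T) u = coboundary N (\<lambda>u. 0 * cup N s T u) u"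
      unfolding cup.simps by (intro coboundary_cong) auto
    then show ?thesis unfolding coboundary_scale by simp
  qed
qed simp

lemma reflect_fun_upd:
  fixes v :: "nat \<Rightarrow> int"
  assumes "q \<noteq> p"
  shows "reflect n c p (v(q := x)) = (reflect n c p v)(q := (if q div n = p div n \<and> q \<le> p then c - x else x))"
  using assms by (auto simp: reflect_def fun_eq_iff)

text \<open>The standard model: block \<open>i\<close> consists of the coordinates \<open>p\<close> with \<open>p div n = i\<close>, and the
  two facets of the box \<open>[0, 2m]\<^sup>N\<close> normal to the axis \<open>p\<close> are identified by \<open>reflect n (2 * m) p\<close>,
  along which the class \<open>s t\<close> changes by the character \<open>\<omega> t (p div n)\<close>.\<close>

locale twisted_box =
  fixes n k :: nat and m :: int and s :: "nat \<Rightarrow> (nat \<Rightarrow> int) \<Rightarrow> bit" and \<omega> :: "nat \<Rightarrow> nat \<Rightarrow> bit"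
  assumes n_pos: "n > 0" and m_pos: "m > 0"
    and twist: "\<And>t p v. t < k * n \<Longrightarrow> p < k * n \<Longrightarrow> v p \<in> {0, 2 * m} \<Longrightarrow>
      s t (reflect n (2 * m) p v) = s t v + \<omega> t (p div n)"
begin

abbreviation "N \<equiv> k * n"

text \<open>The functions \<open>s t\<close> do not descend to the quotient of the box, but the
  products do: a twist adds a constant multiple of the previous product, whose coboundary is
  zero.\<close>

lemma cup_reflect:
  assumes "t \<le> N" "p < N" "v p \<in> {0, 2 * m}"
  shows "cup N s t (reflect n (2 * m) p v) = cup N s t v"
  using assms(1,3)
proof (induction t arbitrary: v)
  case (Suc t)
  let ?r = "reflect n (2 * m) p"
  define g where "g = (\<lambda>u. s t u * cup N s t u)"
  have odd_r: "odd (?r v q) \<longleftrightarrow> odd (v q)" for q by (simp add: reflect_def)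
  have step: "g (?r w) = g w + \<omega> t (p div n) * cup N s t w" if "w p \<in> {0, 2 * m}" for w
    unfolding g_def using Suc.IH[of w] twist[of t p w] that assms(2) Suc.prems(1)
    by (simp add: algebra_simps)
  have "g ((?r v)(q := ?r v q + 1)) + g ((?r v)(q := ?r v q - 1)) =
      (g (v(q := v q + 1)) + \<omega> t (p div n) * cup N s t (v(q := v q + 1))) +
      (g (v(q := v q - 1)) + \<omega> t (p div n) * cup N s t (v(q := v q - 1)))" if "q < N" "odd (v q)" for q
  proof -
    have qp: "q \<noteq> p" using that Suc.prems(2) by auto
    \<comment> \<open>If the axis \<open>q\<close> is reversed, its two neighbours change places,
      which does not affect their sum.\<close>
    define \<epsilon> :: int where "\<epsilon> = (if q div n = p div n \<and> q \<le> p then -1 else 1)"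
    have "(?r v)(q := ?r v q + a) = ?r (v(q := v q + \<epsilon> * a))" for a
      unfolding reflect_fun_upd[OF qp] by (auto simp: \<epsilon>_def reflect_def fun_eq_iff)
    moreover have "g (?r (v(q := x))) = g (v(q := x)) + \<omega> t (p div n) * cup N s t (v(q := x))" for x
      using step[of "v(q := x)"] qp Suc.prems(2) by simp
    ultimately have "g ((?r v)(q := ?r v q + a)) =
        g (v(q := v q + \<epsilon> * a)) + \<omega> t (p div n) * cup N s t (v(q := v q + \<epsilon> * a))" for a
      by simp
    from this[of 1] this[of "-1"] show ?thesis
      by (cases "q div n = p div n \<and> q \<le> p") (auto simp: \<epsilon>_def)
  qed
  then have "coboundary N g (?r v) =
      coboundary N (\<lambda>u. g u + \<omega> t (p div n) * cup N s t u) v"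
    unfolding coboundary_def by (intro sum.cong) (auto simp: odd_r)
  also have "\<dots> = coboundary N g v"
    by (simp add: coboundary_add coboundary_scale cup_cocycle)
  finally show ?case by (simp add: g_def)
qed simp

section \<open>Summation of the product over coordinate faces of the box\<close>

definition cells :: "nat set \<Rightarrow> (nat \<Rightarrow> int) set" where
  "cells F = {v. (\<forall>p\<in>F. odd (v p) \<and> 0 < v p \<and> v p < 2 * m) \<and> (\<forall>p. p \<notin> F \<longrightarrow> v p = 0)}"

text \<open>The product of the first \<open>card F\<close> classes, evaluated on the mod 2 chain of
  all cells of the face spanned by \<open>F\<close> at the origin.\<close>

definition total :: "nat set \<Rightarrow> bit" where
  "total F = (\<Sum>v\<in>cells F. cup N s (card F) v)"

lemma sum_telescope_odd:
  fixes f :: "int \<Rightarrow> bit"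
  shows "(\<Sum>c | odd c \<and> 0 < c \<and> c < 2 * m. f (c + 1) + f (c - 1)) = f (2 * m) + f 0"
proof -
  have "(\<Sum>c | odd c \<and> 0 < c \<and> c < 2 * int l. f (c + 1) + f (c - 1)) = f (2 * int l) + f 0" for l
  proof (induction l)
    case 0
    have "{c. odd c \<and> 0 < c \<and> c < 2 * int 0} = {}" by auto
    then show ?case by (simp only: sum.empty) simp
  next
    case (Suc l)
    have fin: "finite {c. odd c \<and> 0 < c \<and> c < 2 * int l}"
      by (rule finite_subset[of _ "{0..2 * int l}"]) auto
    have "{c. odd c \<and> 0 < c \<and> c < 2 * int (Suc l)} =
        insert (2 * int l + 1) {c. odd c \<and> 0 < c \<and> c < 2 * int l}"
      by (auto elim!: oddE)
    then have "(\<Sum>c | odd c \<and> 0 < c \<and> c < 2 * int (Suc l). f (c + 1) + f (c - 1)) =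
        (f (2 * int l + 2) + f (2 * int l)) + (f (2 * int l) + f 0)"
      using fin Suc by (simp add: add.commute)
    also have "2 * int l + 2 = 2 * int (Suc l)" by simp
    finally show ?case by (simp add: add.commute)
  qed
  from this[of "nat m"] show ?thesis using m_pos by simp
qed

lemma sum_cells_split:
  assumes "p \<in> F"
  shows "(\<Sum>v\<in>cells F. f v) =
    (\<Sum>v\<in>cells (F - {p}). \<Sum>c | odd c \<and> 0 < c \<and> c < 2 * m. f (v(p := c)))"
  unfolding sum.cartesian_product
  by (rule sum.reindex_bij_witness[of _ "\<lambda>(v, c). v(p := c)" "\<lambda>v. (v(p := 0), v p)"])
    (use assms in \<open>auto simp: cells_def split: if_splits\<close>)

lemma sum_cells_involution:
  assumes "\<And>v. v \<in> cells F \<Longrightarrow> h v \<in> cells F" "\<And>v. v \<in> cells F \<Longrightarrow> h (h v) = v"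
  shows "(\<Sum>v\<in>cells F. f (h v)) = (\<Sum>v\<in>cells F. f v)"
  by (rule sum.reindex_bij_witness[of _ h h]) (use assms in auto)

text \<open>If a smaller coordinate of the block of \<open>p\<close> is already fixed at \<open>0\<close>, the reflection at \<open>p\<close>
  moves it to \<open>2m\<close>. Reflecting there as well brings it back, and the two characters cancel.\<close>

lemma facet_contribution:
  assumes F: "F \<subseteq> {..<N}" and p: "p \<in> F" and t: "card F = Suc t"
  defines "g \<equiv> \<lambda>u. s t u * cup N s t u"
  shows "(\<Sum>v\<in>cells (F - {p}). g (v(p := 2 * m)) + g (v(p := 0))) =
    (if \<exists>r<p. r div n = p div n \<and> r \<notin> F then 0 else \<omega> t (p div n)) * total (F - {p})"
proof -
  have fin: "finite F" using F finite_subset by blast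
  have card: "card (F - {p}) = t" using fin p t by simp
  have "card F \<le> N" using card_mono[OF _ F] by simp
  then have tN: "t < N" using t by simp
  have pN: "p < N" using F p by auto
  have v0: "v(p := 0) = v" if "v \<in> cells (F - {p})" for v
    using that by (auto simp: cells_def fun_eq_iff)
  have vp: "v p = 0" if "v \<in> cells (F - {p})" for v
    using that by (auto simp: cells_def)
  have g: "g (reflect n (2 * m) q v) = g v + \<omega> t (q div n) * cup N s t v"
    if "q < N" "v q \<in> {0, 2 * m}" for q v
    unfolding g_def using that tN twist[of t q v] cup_reflect[of t q v] by (simp add: distrib_right)
  \<comment> \<open>Pattern of both cases: an involution \<open>h\<close> of the cells at the near
    end carries the values there to those at the far end \<open>2 * m\<close>. The two sums then
    cancel up to the twist \<open>c\<close>.\<close>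
  have main: ?thesis
    if c: "c = (if \<exists>r<p. r div n = p div n \<and> r \<notin> F then 0 else \<omega> t (p div n))"
      and h: "\<And>v. v \<in> cells (F - {p}) \<Longrightarrow> h v \<in> cells (F - {p})"
        "\<And>v. v \<in> cells (F - {p}) \<Longrightarrow> h (h v) = v"
        "\<And>v. v \<in> cells (F - {p}) \<Longrightarrow> g ((h v)(p := 2 * m)) = g v + c * cup N s t v" for c h
  proof -
    have "(\<Sum>v\<in>cells (F - {p}). g (v(p := 2 * m)) + g (v(p := 0))) =
        (\<Sum>v\<in>cells (F - {p}). g ((h v)(p := 2 * m))) + (\<Sum>v\<in>cells (F - {p}). g v)"
      using sum_cells_involution[of "F - {p}" h "\<lambda>v. g (v(p := 2 * m))"] h(1,2)
      by (simp add: sum.distrib v0)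
    also have "\<dots> = c * total (F - {p}) + ((\<Sum>v\<in>cells (F - {p}). g v) + (\<Sum>v\<in>cells (F - {p}). g v))"
      by (simp only: h(3) sum.distrib total_def card sum_distrib_left add_ac cong: sum.cong)
    also have "\<dots> = c * total (F - {p})" by simp
    finally show ?thesis unfolding c .
  qed
  show ?thesis
  proof (cases "\<exists>r<p. r div n = p div n \<and> r \<notin> F")
    case False
    \<comment> \<open>All smaller coordinates of the block are free, so the reflection keeps them
      strictly inside the box; resetting coordinate \<open>p\<close> to 0 returns to the near
      end.\<close>
    define h where "h v = (reflect n (2 * m) p v)(p := 0)" for v :: "nat \<Rightarrow> int"
    have h: "h v j = (if j div n = p div n \<and> j < p then 2 * m - v j else if j = p then 0 else v j)"
      for v j by (simp add: h_def reflect_def)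
    show ?thesis
    proof (rule main[of "\<omega> t (p div n)" h])
      fix v assume v: "v \<in> cells (F - {p})"
      show "h v \<in> cells (F - {p})"
        unfolding cells_def mem_Collect_eq
      proof (intro conjI ballI allI impI)
        fix j assume "j \<in> F - {p}"
        then have "odd (v j)" "0 < v j" "v j < 2 * m" "j \<noteq> p" using v by (auto simp: cells_def)
        then show "odd (h v j)" "0 < h v j" "h v j < 2 * m" by (simp_all add: h)
      next
        fix j assume j: "j \<notin> F - {p}"
        then have "v j = 0" using v by (simp add: cells_def)
        moreover have "\<not> (j div n = p div n \<and> j < p)" using j False by blast
        ultimately show "h v j = 0" by (simp only: h if_False split: if_split) simp
      qed
      show "h (h v) = v" by (rule ext) (use vp[OF v] in \<open>simp add: h\<close>)
      have "(h v)(p := 2 * m) = reflect n (2 * m) p v"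
        using vp[OF v] by (simp add: h_def reflect_def fun_eq_iff)
      then show "g ((h v)(p := 2 * m)) = g v + \<omega> t (p div n) * cup N s t v"
        using g[OF pN] vp[OF v] by simp
    qed (use False in auto)
  next
    case True
    \<comment> \<open>With the largest fixed coordinate \<open>r\<close> below \<open>p\<close>, the
      double reflection reverses only coordinates strictly between \<open>r\<close> and
      \<open>p\<close>, and these are all free.\<close>
    let ?R = "{r. r < p \<and> r div n = p div n \<and> r \<notin> F}"
    define r where "r = Max ?R"
    have "r \<in> ?R" unfolding r_def by (rule Max_in) (use True in auto)
    moreover have "j \<le> r" if "j \<in> ?R" for j unfolding r_def using that by (intro Max_ge) auto
    ultimately have r: "r < p" "r div n = p div n" "r \<notin> F"
      and r_max: "\<And>j. j < p \<Longrightarrow> j div n = p div n \<Longrightarrow> j \<notin> F \<Longrightarrow> j \<le> r" by auto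
    define h where "h v = (reflect n (2 * m) r (reflect n (2 * m) p v))(p := 0)" for v :: "nat \<Rightarrow> int"
    have h: "h v j = (if j div n = p div n \<and> r < j \<and> j < p then 2 * m - v j else if j = p then 0 else v j)"
      for v j using r by (auto simp: h_def reflect_def)
    show ?thesis
    proof (rule main[of 0 h])
      fix v assume v: "v \<in> cells (F - {p})"
      show "h v \<in> cells (F - {p})"
        unfolding cells_def mem_Collect_eq
      proof (intro conjI ballI allI impI)
        fix j assume "j \<in> F - {p}"
        then have "odd (v j)" "0 < v j" "v j < 2 * m" "j \<noteq> p" using v by (auto simp: cells_def)
        then show "odd (h v j)" "0 < h v j" "h v j < 2 * m" by (simp_all add: h)
      next
        fix j assume j: "j \<notin> F - {p}"
        then have "v j = 0" using v by (simp add: cells_def)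
        moreover have "\<not> (j div n = p div n \<and> r < j \<and> j < p)"
          using j r_max[of j] by (metis Diff_iff less_irrefl linorder_not_less singletonD)
        ultimately show "h v j = 0" by (simp only: h if_False split: if_split) simp
      qed
      show "h (h v) = v" by (rule ext) (use vp[OF v] in \<open>simp add: h\<close>)
      have "(h v)(p := 2 * m) = reflect n (2 * m) r (reflect n (2 * m) p v)"
        using vp[OF v] r by (simp add: h_def reflect_def fun_eq_iff)
      moreover have "reflect n (2 * m) p v r = 2 * m"
        using v r by (auto simp: reflect_def cells_def)
      moreover have "cup N s t (reflect n (2 * m) p v) = cup N s t v"
        using vp[OF v] tN pN by (intro cup_reflect) auto
      ultimately have "g ((h v)(p := 2 * m)) =
          g v + \<omega> t (p div n) * cup N s t v + \<omega> t (r div n) * cup N s t v"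
        using g[OF pN, of v] g[of r "reflect n (2 * m) p v"] r(1) pN vp[OF v] by simp
      then show "g ((h v)(p := 2 * m)) = g v + 0 * cup N s t v"
        using r(2) by (simp add: add.assoc)
    qed (use True in auto)
  qed
qed

text \<open>Stokes' theorem: along each axis of \<open>F\<close> the sum telescopes to the two end
  facets, and these differ by the twist.\<close>

lemma total_step:
  assumes F: "F \<subseteq> {..<N}" and t: "card F = Suc t"
  shows "total F = (\<Sum>p\<in>F.
    (if \<exists>r<p. r div n = p div n \<and> r \<notin> F then 0 else \<omega> t (p div n)) * total (F - {p}))"
proof -
  define g where "g = (\<lambda>u. s t u * cup N s t u)"
  have "total F = (\<Sum>v\<in>cells F. \<Sum>p\<in>F. g (v(p := v p + 1)) + g (v(p := v p - 1)))"
    unfolding total_def t cup.simps coboundary_def g_def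
  proof (intro sum.cong refl)
    fix v assume "v \<in> cells F"
    then show "{p. p < N \<and> odd (v p)} = F" using F by (auto simp: cells_def)
  qed
  also have "\<dots> = (\<Sum>p\<in>F. \<Sum>v\<in>cells F. g (v(p := v p + 1)) + g (v(p := v p - 1)))"
    by (rule sum.swap)
  also have "\<dots> = (\<Sum>p\<in>F. \<Sum>v\<in>cells (F - {p}). g (v(p := 2 * m)) + g (v(p := 0)))"
  proof (rule sum.cong[OF refl])
    fix p assume "p \<in> F"
    then show "(\<Sum>v\<in>cells F. g (v(p := v p + 1)) + g (v(p := v p - 1))) =
        (\<Sum>v\<in>cells (F - {p}). g (v(p := 2 * m)) + g (v(p := 0)))"
      unfolding sum_cells_split[OF \<open>p \<in> F\<close>]
      using sum_telescope_odd[of "\<lambda>c. g (_(p := c))"] by simp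
  qed
  also have "\<dots> = (\<Sum>p\<in>F.
    (if \<exists>r<p. r div n = p div n \<and> r \<notin> F then 0 else \<omega> t (p div n)) * total (F - {p}))"
    unfolding g_def using facet_contribution[OF F _ t] by (intro sum.cong) auto
  finally show ?thesis .
qed

lemma total_empty: "total {} = 1"
proof -
  have "cells {} = {\<lambda>_. 0}" by (auto simp: cells_def)
  then show ?thesis by (simp add: total_def)
qed

text \<open>In the recursion, removing \<open>q\<close> has coefficient zero because of the gap at
  \<open>r\<close>, and removing any other coordinate keeps this gap.\<close>

lemma total_eq_0:
  assumes "F \<subseteq> {..<N}" "q \<in> F" "r < q" "r div n = q div n" "r \<notin> F"
  shows "total F = 0"
  using assms
proof (induction "card F" arbitrary: F)
  case 0
  then show ?case using finite_subset[of F "{..<N}"] by auto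
next
  case (Suc t)
  have "(if \<exists>r<p. r div n = p div n \<and> r \<notin> F then 0 else \<omega> t (p div n)) * total (F - {p}) = 0"
    if "p \<in> F" for p
  proof (cases "p = q")
    case True
    then show ?thesis using Suc.prems by auto
  next
    case False
    have "finite F" using Suc.prems(1) finite_subset by blast
    then have "t = card (F - {p})" using that Suc.hyps(2) by simp
    then have "total (F - {p}) = 0" using Suc.prems False by (intro Suc.hyps(1)) auto
    then show ?thesis by simp
  qed
  then show ?case unfolding total_step[OF Suc.prems(1) Suc.hyps(2)[symmetric]] by (intro sum.neutral) blast
qed

section \<open>Products of projective subspaces and the binomial count\<close>

definition initial_coords :: "(nat \<Rightarrow> nat) \<Rightarrow> nat set" where
  "initial_coords r = {p. p < N \<and> p mod n < r (p div n)}"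

lemma block_index:
  assumes "i < k" "l < n"
  shows "i * n + l < N" "(i * n + l) div n = i" "(i * n + l) mod n = l"
proof -
  have "Suc i * n \<le> k * n" using assms(1) by (intro mult_le_mono1) simp
  then show "i * n + l < N" using assms(2) by simp
qed (use assms in auto)

lemma div_less_blocks: "p < N \<Longrightarrow> p div n < k"
  by (simp add: less_mult_imp_div_less)

lemma card_initial_coords:
  assumes "\<And>i. i < k \<Longrightarrow> r i \<le> n"
  shows "card (initial_coords r) = (\<Sum>i<k. r i)"
proof -
  have "bij_betw (\<lambda>(i, l). i * n + l) (SIGMA i:{..<k}. {..<r i}) (initial_coords r)"
  proof (rule bij_betw_byWitness[where f' = "\<lambda>p. (p div n, p mod n)"])
    show "\<forall>a\<in>SIGMA i:{..<k}. {..<r i}. ((case a of (i, l) \<Rightarrow> i * n + l) div n, (case a of (i, l) \<Rightarrow> i * n + l) mod n) = a"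
      using assms by (force simp: block_index)
    show "(\<lambda>(i, l). i * n + l) ` (SIGMA i:{..<k}. {..<r i}) \<subseteq> initial_coords r"
      using assms by (force simp: initial_coords_def block_index)
  qed (auto simp: initial_coords_def div_less_blocks)
  then have "card (initial_coords r) = card (SIGMA i:{..<k}. {..<r i})"
    by (simp add: bij_betw_same_card)
  then show ?thesis by simp
qed

text \<open>Removing any but the last chosen coordinate of a block opens a gap. What survives is the
  rule for coefficients of monomials with exponents \<open>r\<close> under multiplication by the sum
  of the \<open>\<omega> T i\<close> w_i.\<close>

lemma total_initial_step:
  assumes r: "\<And>i. i < k \<Longrightarrow> r i \<le> n" and T: "(\<Sum>i<k. r i) = Suc T"
  shows "total (initial_coords r) =
    (\<Sum>i | i < k \<and> 0 < r i. \<omega> T i * total (initial_coords (r(i := r i - 1))))"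
proof -
  let ?F = "initial_coords r"
  have F: "?F \<subseteq> {..<N}" by (auto simp: initial_coords_def)
  have fin: "finite ?F" using F finite_subset by blast
  have down: "q \<in> ?F" if "p \<in> ?F" "q < p" "q div n = p div n" for p q
  proof -
    have "q mod n \<le> p mod n"
      using that(2,3) by (metis div_mult_mod_eq less_imp_le nat_add_left_cancel_le)
    then show ?thesis using that by (auto simp: initial_coords_def)
  qed
  have "card ?F = Suc T" using card_initial_coords[of r] r T by simp
  from total_step[OF F this] have "total ?F = (\<Sum>p\<in>?F. \<omega> T (p div n) * total (?F - {p}))"
    using down by (auto intro!: sum.cong)
  also have "\<dots> = (\<Sum>p | p \<in> ?F \<and> Suc (p mod n) = r (p div n). \<omega> T (p div n) * total (?F - {p}))"
  proof (rule sum.mono_neutral_right[OF fin])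
    show "\<forall>p\<in>?F - {p \<in> ?F. Suc (p mod n) = r (p div n)}. \<omega> T (p div n) * total (?F - {p}) = 0"
    proof
      fix p assume p: "p \<in> ?F - {p \<in> ?F. Suc (p mod n) = r (p div n)}"
      define i l where "i = p div n" and "l = p mod n"
      have i: "i < k" using p by (auto simp: initial_coords_def i_def div_less_blocks)
      have l: "Suc l < r i" using p by (auto simp: initial_coords_def i_def l_def)
      have "i * n + Suc l = Suc p" by (simp add: i_def l_def)
      moreover have "i * n + Suc l \<in> ?F" "(i * n + Suc l) div n = i"
        using block_index[of i "Suc l"] i l r[OF i] by (auto simp: initial_coords_def)
      ultimately have "total (?F - {p}) = 0"
        using F i_def by (intro total_eq_0[of _ "Suc p" p]) auto
      then show "\<omega> T (p div n) * total (?F - {p}) = 0" by simp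
    qed
  qed auto
  also have "\<dots> = (\<Sum>i | i < k \<and> 0 < r i. \<omega> T i * total (initial_coords (r(i := r i - 1))))"
  proof (rule sum.reindex_bij_witness[of _ "\<lambda>i. i * n + (r i - 1)" "\<lambda>p. p div n"])
    fix p assume p: "p \<in> {p. p \<in> ?F \<and> Suc (p mod n) = r (p div n)}"
    then show "p div n * n + (r (p div n) - 1) = p"
      by (metis (mono_tags, lifting) diff_Suc_1 div_mult_mod_eq mem_Collect_eq)
    show "p div n \<in> {i. i < k \<and> 0 < r i}"
      using p by (auto simp: initial_coords_def div_less_blocks)
    have "q mod n = r (p div n) - 1 \<longleftrightarrow> q = p" if "q div n = p div n" for q
      using that p by (metis (mono_tags, lifting) diff_Suc_1 div_mult_mod_eq mem_Collect_eq)
    moreover have "Suc (p mod n) = r (p div n)" using p by simp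
    ultimately have "q mod n < (r(p div n := r (p div n) - 1)) (q div n) \<longleftrightarrow> q mod n < r (q div n) \<and> q \<noteq> p" for q
      by (cases "q div n = p div n") (force, auto)
    then have "initial_coords (r(p div n := r (p div n) - 1)) = ?F - {p}"
      unfolding initial_coords_def by blast
    then show "\<omega> T (p div n) * total (initial_coords (r(p div n := r (p div n) - 1))) =
      \<omega> T (p div n) * total (?F - {p})" by simp
  next
    fix i assume "i \<in> {i. i < k \<and> 0 < r i}"
    then have i: "i < k" "0 < r i" "r i - 1 < n" using r[of i] by auto
    show "(i * n + (r i - 1)) div n = i" using block_index i by blast
    show "i * n + (r i - 1) \<in> {p. p \<in> ?F \<and> Suc (p mod n) = r (p div n)}"
      using block_index[OF i(1,3)] i by (auto simp: initial_coords_def)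
  qed
  finally show ?thesis .
qed

text \<open>This is the coefficient of the monomial with exponents \<open>r\<close> in the product
  of the factors w_0 + w_(J t). Collecting equal factors, one chooses w_j from \<open>r j\<close> of
  the factors w_0 + w_j; the exponent of w_0 then follows from the degree.\<close>

lemma total_initial:
  assumes \<omega>: "\<And>t i. t < N \<Longrightarrow> i < k \<Longrightarrow> \<omega> t i = of_bool (i = 0 \<or> i = J t)"
    and J: "\<And>t. t < N \<Longrightarrow> J t \<in> {1..<k}"
    and r: "\<And>i. i < k \<Longrightarrow> r i \<le> n" and T: "(\<Sum>i<k. r i) = T"
  shows "total (initial_coords r) = of_nat (\<Prod>j\<in>{1..<k}. card {t. t < T \<and> J t = j} choose r j)"
  using r T
proof (induction T arbitrary: r)
  case 0
  then have r0: "r i = 0" if "i < k" for i using that by simp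
  then have "initial_coords r = {}" by (auto simp: initial_coords_def div_less_blocks)
  then show ?case using r0 by (simp add: total_empty)
next
  case (Suc T)
  define D where "D T j = card {t. t < T \<and> J t = j}" for T j
  have sum_le: "(\<Sum>i<k. r i) \<le> (\<Sum>i<k. n)" using Suc.prems(1) by (intro sum_mono) auto
  then have TN: "T < N" using Suc.prems(2) by simp
  define j where "j = J T"
  have j: "0 < j" "j < k" using J[OF TN] by (auto simp: j_def)
  have D_Suc: "D (Suc T) i = D T i + of_bool (i = j)" for i
  proof -
    have "{t. t < Suc T \<and> J t = i} = (if i = j then insert T {t. t < T \<and> J t = i} else {t. t < T \<and> J t = i})"
      by (auto simp: j_def less_Suc_eq)
    then show ?thesis by (simp add: D_def)
  qed
  have sum_dec: "(\<Sum>i<k. (r(i0 := r i0 - 1)) i) = T" if "i0 < k" "0 < r i0" for i0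
  proof -
    have "(\<Sum>i<k. r i) = (\<Sum>i<k. (r(i0 := r i0 - 1)) i + of_bool (i = i0))"
      using that by (intro sum.cong) auto
    also have "\<dots> = (\<Sum>i<k. (r(i0 := r i0 - 1)) i) + 1"
      using that by (simp add: sum.distrib of_bool_def)
    finally show ?thesis using Suc.prems(2) by simp
  qed
  have IH: "total (initial_coords (r(i := r i - 1))) = of_nat (\<Prod>l\<in>{1..<k}. D T l choose (r(i := r i - 1)) l)"
    if "i < k" "0 < r i" for i
    unfolding D_def
  proof (rule Suc.IH)
    show "(r(i := r i - 1)) l \<le> n" if "l < k" for l
      using Suc.prems(1)[OF that] by auto
  qed (rule sum_dec[OF that])
  define P where "P = (\<Prod>l\<in>{1..<k} - {j}. D T l choose r l)"
  have split: "(\<Prod>l\<in>{1..<k}. f l) = f j * (\<Prod>l\<in>{1..<k} - {j}. f l)" for f :: "nat \<Rightarrow> nat"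
    using j by (intro prod.remove) auto
  have A: "(if 0 < r 0 then total (initial_coords (r(0 := r 0 - 1))) else 0) = of_nat ((D T j choose r j) * P)"
  proof (cases "0 < r 0")
    case True
    have "(\<Prod>l\<in>{1..<k}. D T l choose (r(0 := r 0 - 1)) l) = (\<Prod>l\<in>{1..<k}. D T l choose r l)"
      by (intro prod.cong) auto
    then have "total (initial_coords (r(0 := r 0 - 1))) = of_nat (\<Prod>l\<in>{1..<k}. D T l choose r l)"
      using True IH[of 0] j by simp
    then show ?thesis using True unfolding split P_def by simp
  next
    case False
    \<comment> \<open>Without any w_0, the first \<open>T\<close> factors would have to leave room
      for \<open>Suc T\<close> factors w_l with l > 0; so some binomial coefficient is zero, in
      agreement with the missing term.\<close>
    have "(\<Sum>l\<in>{1..<k}. D T l) = T"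
    proof -
      have "card (\<Union>l\<in>{1..<k}. {t. t < T \<and> J t = l}) = (\<Sum>l\<in>{1..<k}. D T l)"
        unfolding D_def by (intro card_UN_disjoint) auto
      moreover have "(\<Union>l\<in>{1..<k}. {t. t < T \<and> J t = l}) = {..<T}"
        using J TN by fastforce
      ultimately show ?thesis by simp
    qed
    moreover have "(\<Sum>l\<in>{1..<k}. r l) = Suc T"
    proof -
      have "{..<k} = insert 0 {1..<k}" using j by auto
      then show ?thesis using Suc.prems(2) False by simp
    qed
    ultimately obtain l where l: "l \<in> {1..<k}" "D T l < r l"
      by (metis Suc_n_not_le_n not_less sum_mono)
    then have "(\<Prod>l\<in>{1..<k}. D T l choose r l) = 0"
      by (auto simp: binomial_eq_0_iff)
    then have "(D T j choose r j) * P = 0" unfolding split P_def .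
    then show ?thesis using False by (simp only: if_False of_nat_0)
  qed
  have B: "(if 0 < r j then total (initial_coords (r(j := r j - 1))) else 0) =
      of_nat ((if 0 < r j then D T j choose (r j - 1) else 0) * P)"
  proof (cases "0 < r j")
    case True
    have "(\<Prod>l\<in>{1..<k} - {j}. D T l choose (r(j := r j - 1)) l) = P"
      unfolding P_def by (intro prod.cong) auto
    then have "(\<Prod>l\<in>{1..<k}. D T l choose (r(j := r j - 1)) l) = (D T j choose (r j - 1)) * P"
      unfolding split by simp
    then show ?thesis using IH[OF j(2) True] True by (simp only: if_True)
  qed simp
  have "total (initial_coords r) =
      (\<Sum>i | i < k \<and> 0 < r i. \<omega> T i * total (initial_coords (r(i := r i - 1))))"
    by (rule total_initial_step[OF Suc.prems])
  also have "\<dots> = (\<Sum>i<k. if 0 < r i then \<omega> T i * total (initial_coords (r(i := r i - 1))) else 0)"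
    by (subst sum.inter_filter[symmetric]) (auto intro: sum.cong)
  also have "\<dots> = (\<Sum>i\<in>{0,j}. if 0 < r i then total (initial_coords (r(i := r i - 1))) else 0)"
    using j \<omega>[OF TN] by (intro sum.mono_neutral_cong_right) (auto simp: j_def)
  also have "\<dots> = of_nat (((D T j choose r j) + (if 0 < r j then D T j choose (r j - 1) else 0)) * P)"
    using A B j by (simp add: distrib_right)
  \<comment> \<open>Pascal's rule: factor \<open>T\<close> supplies either w_0 or w_j.\<close>
  also have "(D T j choose r j) + (if 0 < r j then D T j choose (r j - 1) else 0) = D (Suc T) j choose r j"
    by (cases "r j") (auto simp: D_Suc)
  also have "(D (Suc T) j choose r j) * P = (\<Prod>l\<in>{1..<k}. D (Suc T) l choose r l)"
    unfolding split P_def by (simp add: D_Suc)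
  finally show ?case by (simp add: D_def)
qed

text \<open>The sum over all top cells is 1, so the product is nonzero on one of them, and on that
  cell no factor can be constant.\<close>

lemma nonconstant_class:
  assumes \<omega>: "\<And>t i. t < N \<Longrightarrow> i < k \<Longrightarrow> \<omega> t i = of_bool (i = 0 \<or> i = J t)"
    and J: "\<And>t. t < N \<Longrightarrow> J t \<in> {1..<k}"
    and odd: "\<And>j. j \<in> {1..<k} \<Longrightarrow> odd (card {t. t < N \<and> J t = j} choose n)"
  shows "\<exists>v. (\<forall>p<N. 0 < v p \<and> v p < 2 * m) \<and> (\<forall>p\<ge>N. v p = 0) \<and>
    (\<forall>t<N. \<exists>u. face N u v \<and> s t u \<noteq> s t v)"
proof -
  have all: "initial_coords (\<lambda>i. n) = {..<N}" using n_pos by (auto simp: initial_coords_def)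
  have "total {..<N} = of_nat (\<Prod>j\<in>{1..<k}. card {t. t < N \<and> J t = j} choose n)"
    using total_initial[OF \<omega> J, of "\<lambda>i. n" N] by (simp add: all)
  also have "\<dots> = 1"
  proof -
    have "odd (\<Prod>j\<in>{1..<k}. card {t. t < N \<and> J t = j} choose n)"
      using odd by (simp add: even_prod_iff)
    then show ?thesis by (rule of_nat_odd_bit)
  qed
  finally have "(\<Sum>v\<in>cells {..<N}. cup N s N v) \<noteq> 0" by (simp add: total_def)
  then obtain v where v: "v \<in> cells {..<N}" "cup N s N v \<noteq> 0"
    by (meson sum.neutral)
  have "\<exists>u. face N u v \<and> s t u \<noteq> s t v" if "t < N" for t
    using cup_vanish[of N v s t "s t v" N v] that v(2) by (auto simp: face_def)
  then show ?thesis using v(1) by (intro exI[of _ v]) (auto simp: cells_def)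
qed

end

section \<open>Charts of projective space and lifting to the sphere\<close>

definition ip :: "nat \<Rightarrow> (nat \<Rightarrow> real) \<Rightarrow> (nat \<Rightarrow> real) \<Rightarrow> real" where
  "ip n x y = (\<Sum>i\<le>n. x i * y i)"

text \<open>The affine chart that omits the hyperplane orthogonal to \<open>a\<close>.\<close>

definition chart :: "nat \<Rightarrow> (nat \<Rightarrow> real) \<Rightarrow> (nat \<Rightarrow> real) set set" where
  "chart n a = antipodal_class ` {x \<in> topspace (nsphere n). ip n x a \<noteq> 0}"

definition representative :: "nat \<Rightarrow> (nat \<Rightarrow> real) \<Rightarrow> (nat \<Rightarrow> real) set \<Rightarrow> nat \<Rightarrow> real" where
  "representative n a c = (THE x. x \<in> c \<and> ip n x a > 0)"

lemma in_nsphere_iff: "x \<in> topspace (nsphere n) \<longleftrightarrow> ip n x x = 1 \<and> (\<forall>i>n. x i = 0)"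
  by (simp add: nsphere ip_def power2_eq_square)

lemma ip_minus [simp]: "ip n (\<lambda>i. - x i) y = - ip n x y" "ip n x (\<lambda>i. - y i) = - ip n x y"
  by (simp_all add: ip_def sum_negf)

lemma neg_in_nsphere [simp]: "(\<lambda>i. - x i) \<in> topspace (nsphere n) \<longleftrightarrow> x \<in> topspace (nsphere n)"
  by (simp add: in_nsphere_iff)

lemma neg_neq_nsphere: "x \<in> topspace (nsphere n) \<Longrightarrow> x \<noteq> (\<lambda>i. - x i)"
proof
  assume "x \<in> topspace (nsphere n)" "x = (\<lambda>i. - x i)"
  then have "ip n x x = 1" "ip n x x = - ip n x x"
    using ip_minus(1)[of n x x] by (simp_all add: in_nsphere_iff)
  then show False by simp
qed

lemma antipodal_class_eq_iff:
  "antipodal_class x = antipodal_class y \<longleftrightarrow> x = y \<or> x = (\<lambda>i. - y i)"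
  by (auto simp: antipodal_class_def doubleton_eq_iff)

lemma antipodal_class_neg [simp]: "antipodal_class (\<lambda>i. - x i) = antipodal_class x"
  by (auto simp: antipodal_class_def)

lemma continuous_map_nsphere_iff:
  "continuous_map X (nsphere n) f \<longleftrightarrow>
    (\<forall>i. continuous_map X euclideanreal (\<lambda>x. f x i)) \<and> f \<in> topspace X \<rightarrow> topspace (nsphere n)"
  unfolding nsphere continuous_map_in_subtopology continuous_map_componentwise_UNIV by simp

lemma continuous_map_ip:
  assumes "\<And>i. i \<le> n \<Longrightarrow> continuous_map X euclideanreal (\<lambda>x. f x i)"
    "\<And>i. i \<le> n \<Longrightarrow> continuous_map X euclideanreal (\<lambda>x. g x i)"
  shows "continuous_map X euclideanreal (\<lambda>x. ip n (f x) (g x))"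
  unfolding ip_def using assms by (intro continuous_map_sum continuous_map_real_mult) auto

lemma quotient_map_projective:
  "quotient_map (nsphere n) (real_projective_space n) antipodal_class"
  unfolding real_projective_space_def by (rule quotient_map_quotient_topology)

lemma continuous_map_antipodal_class:
  "continuous_map (nsphere n) (real_projective_space n) antipodal_class"
  by (rule quotient_imp_continuous_map[OF quotient_map_projective])

lemma topspace_projective: "topspace (real_projective_space n) = antipodal_class ` topspace (nsphere n)"
  by (simp add: real_projective_space_def)

lemma antipodal_class_in_chart_iff:
  assumes "x \<in> topspace (nsphere n)"
  shows "antipodal_class x \<in> chart n a \<longleftrightarrow> ip n x a \<noteq> 0"
  using assms by (auto simp: chart_def antipodal_class_eq_iff image_iff)

lemma openin_chart: "openin (real_projective_space n) (chart n a)"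
proof -
  have "{x \<in> topspace (nsphere n). antipodal_class x \<in> chart n a} =
      {x \<in> topspace (nsphere n). ip n x a \<in> - {0}}"
    by (auto simp: antipodal_class_in_chart_iff)
  moreover have "openin (nsphere n) {x \<in> topspace (nsphere n). ip n x a \<in> - {0}}"
    by (rule openin_continuous_map_preimage[OF continuous_map_ip])
      (auto simp: continuous_map_nsphere_projection)
  ultimately show ?thesis
    unfolding real_projective_space_def openin_quotient_topology by (auto simp: chart_def)
qed

lemma representative_antipodal_class:
  assumes "ip n x a \<noteq> 0"
  shows "representative n a (antipodal_class x) = (\<lambda>i. sgn (ip n x a) * x i)"
proof (cases "ip n x a > 0")
  case True
  then show ?thesis
    unfolding representative_def by (intro the_equality) (auto simp: antipodal_class_def)
next
  case False
  then have "ip n x a < 0" using assms by simp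
  then show ?thesis
    unfolding representative_def by (intro the_equality) (auto simp: antipodal_class_def)
qed

lemma representative:
  assumes "c \<in> chart n a"
  shows "representative n a c \<in> topspace (nsphere n)" "antipodal_class (representative n a c) = c"
    "ip n (representative n a c) a > 0"
proof -
  obtain x where x: "x \<in> topspace (nsphere n)" "ip n x a \<noteq> 0" "c = antipodal_class x"
    using assms by (auto simp: chart_def)
  have "representative n a c \<in> topspace (nsphere n) \<and> antipodal_class (representative n a c) = c \<and>
      ip n (representative n a c) a > 0"
    using x by (cases "ip n x a > 0") (simp_all add: representative_antipodal_class not_less)
  then show "representative n a c \<in> topspace (nsphere n)" "antipodal_class (representative n a c) = c"
    "ip n (representative n a c) a > 0" by auto
qed

text \<open>Over an open chart the projection remains a quotient map, so continuity may be checked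
  on the sphere. There the representative of \<open>x\<close> is \<open>x\<close> times the sign of
  its inner product with \<open>a\<close>.\<close>

lemma continuous_map_representative:
  "continuous_map (subtopology (real_projective_space n) (chart n a)) (nsphere n) (representative n a)"
proof -
  let ?S = "{x \<in> topspace (nsphere n). ip n x a \<noteq> 0}"
  have "quotient_map (subtopology (nsphere n) ?S)
      (subtopology (real_projective_space n) (chart n a)) antipodal_class"
    using openin_chart
    by (intro quotient_map_restriction[OF quotient_map_projective])
      (auto simp: antipodal_class_in_chart_iff)
  moreover have "continuous_map (subtopology (nsphere n) ?S) (nsphere n)
      (representative n a \<circ> antipodal_class)"
    unfolding continuous_map_nsphere_iff
  proof (intro conjI allI)
    fix i
    have ip: "continuous_map (subtopology (nsphere n) ?S) euclideanreal (\<lambda>x. ip n x a)"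
      by (intro continuous_map_ip continuous_map_from_subtopology)
        (auto simp: continuous_map_nsphere_projection)
    have xi: "continuous_map (subtopology (nsphere n) ?S) euclideanreal (\<lambda>x. x i)"
      by (intro continuous_map_from_subtopology) (auto simp: continuous_map_nsphere_projection)
    have "continuous_map (subtopology (nsphere n) ?S) euclideanreal
        (\<lambda>x. ip n x a / \<bar>ip n x a\<bar> * x i)"
      using ip xi by (intro continuous_map_real_mult continuous_map_real_divide continuous_map_real_abs) auto
    then show "continuous_map (subtopology (nsphere n) ?S) euclideanreal
        (\<lambda>x. (representative n a \<circ> antipodal_class) x i)"
      by (rule continuous_map_eq) (auto simp: representative_antipodal_class real_sgn_eq)
  next
    show "representative n a \<circ> antipodal_class \<in> topspace (subtopology (nsphere n) ?S) \<rightarrow> topspace (nsphere n)"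
      by (auto simp: representative antipodal_class_in_chart_iff)
  qed
  ultimately show ?thesis by (rule continuous_compose_quotient_map)
qed

section \<open>Lifts along the double cover and the sign of a path\<close>

definition lift_on :: "nat \<Rightarrow> ('a::topological_space \<Rightarrow> (nat \<Rightarrow> real) set) \<Rightarrow> 'a set \<Rightarrow> ('a \<Rightarrow> nat \<Rightarrow> real) \<Rightarrow> bool" where
  "lift_on n H S f \<longleftrightarrow> continuous_map (top_of_set S) (nsphere n) f \<and> (\<forall>z\<in>S. antipodal_class (f z) = H z)"

lemma lift_on_subset: "lift_on n H T f \<Longrightarrow> S \<subseteq> T \<Longrightarrow> lift_on n H S f"
  unfolding lift_on_def by (auto intro: continuous_map_from_subtopology_mono)

lemma lift_on_continuous: "lift_on n H S f \<Longrightarrow> continuous_on S (\<lambda>z. f z i)"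
  unfolding lift_on_def continuous_map_nsphere_iff by (auto simp: continuous_map_iff_continuous)

lemma lift_on_sphere: "lift_on n H S f \<Longrightarrow> z \<in> S \<Longrightarrow> f z \<in> topspace (nsphere n)"
  unfolding lift_on_def continuous_map_nsphere_iff by auto

lemma lift_onI:
  assumes "\<And>i. continuous_on S (\<lambda>z. f z i)" "\<And>z. z \<in> S \<Longrightarrow> f z \<in> topspace (nsphere n)"
    "\<And>z. z \<in> S \<Longrightarrow> antipodal_class (f z) = H z"
  shows "lift_on n H S f"
  using assms unfolding lift_on_def continuous_map_nsphere_iff by (auto simp: continuous_map_iff_continuous)

lemma lift_on_neg:
  assumes "lift_on n H S f"
  shows "lift_on n H S (\<lambda>z i. - f z i)"
proof (rule lift_onI)
  show "continuous_on S (\<lambda>z. - f z i)" for i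
    using lift_on_continuous[OF assms] by (rule continuous_on_minus)
  show "(\<lambda>i. - f z i) \<in> topspace (nsphere n)" if "z \<in> S" for z
    using lift_on_sphere[OF assms that] by simp
  show "antipodal_class (\<lambda>i. - f z i) = H z" if "z \<in> S" for z
    using assms that by (simp add: lift_on_def)
qed

text \<open>The inner product of the two lifts is continuous with values 1 and -1 only, hence
  constant on a connected set.\<close>

lemma lifts_agree_up_to_sign:
  assumes "connected S" "lift_on n H S f" "lift_on n H S g"
  shows "(\<forall>z\<in>S. f z = g z) \<or> (\<forall>z\<in>S. f z = (\<lambda>i. - g z i))"
proof -
  have pm: "f z = g z \<and> ip n (f z) (g z) = 1 \<or> f z = (\<lambda>i. - g z i) \<and> ip n (f z) (g z) = -1"
    if "z \<in> S" for z
  proof -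
    have "ip n (g z) (g z) = 1" using lift_on_sphere[OF assms(3) that] by (simp add: in_nsphere_iff)
    moreover have "antipodal_class (f z) = antipodal_class (g z)"
      using assms(2,3) that by (simp add: lift_on_def)
    ultimately show ?thesis by (auto simp: antipodal_class_eq_iff)
  qed
  have "continuous_on S (\<lambda>z. ip n (f z) (g z))"
    unfolding ip_def
    by (intro continuous_on_sum continuous_on_mult lift_on_continuous[OF assms(2)] lift_on_continuous[OF assms(3)])
  moreover have "(\<lambda>z. ip n (f z) (g z)) ` S \<subseteq> {1, -1}" using pm by auto
  then have "finite ((\<lambda>z. ip n (f z) (g z)) ` S)" by (rule finite_subset) simp
  ultimately have "(\<lambda>z. ip n (f z) (g z)) constant_on S"
    using assms(1) continuous_finite_range_constant by blast
  then obtain c where c: "\<And>z. z \<in> S \<Longrightarrow> ip n (f z) (g z) = c" by (auto simp: constant_on_def)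
  show ?thesis
  proof (cases "c = 1")
    case True
    then have "f z = g z" if "z \<in> S" for z using pm[OF that] c[OF that] by auto
    then show ?thesis by blast
  next
    case False
    then have "f z = (\<lambda>i. - g z i)" if "z \<in> S" for z using pm[OF that] c[OF that] by auto
    then show ?thesis by blast
  qed
qed

lemma lift_glue:
  assumes "closed S" "closed T" "connected (S \<inter> T)" and lifts: "lift_on n H S f" "lift_on n H T g"
  shows "\<exists>h. lift_on n H (S \<union> T) h"
proof -
  have "\<exists>g'. lift_on n H T g' \<and> (\<forall>z\<in>S \<inter> T. f z = g' z)"
    using lifts_agree_up_to_sign[OF assms(3), of n H f g] lift_on_neg[OF lifts(2)] lifts
      lift_on_subset[OF lifts(1), of "S \<inter> T"] lift_on_subset[OF lifts(2), of "S \<inter> T"]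
    by (auto intro: exI[of _ g] exI[of _ "\<lambda>z i. - g z i"])
  then obtain g' where g': "lift_on n H T g'" "\<And>z. z \<in> S \<inter> T \<Longrightarrow> f z = g' z" by auto
  have "lift_on n H (S \<union> T) (\<lambda>z. if z \<in> S then f z else g' z)"
  proof (rule lift_onI)
    fix i
    have "continuous_on (S \<union> T) (\<lambda>z. if z \<in> S then f z i else g' z i)"
      using assms(1,2) lift_on_continuous[OF lifts(1)] lift_on_continuous[OF g'(1)] g'(2)
      by (intro continuous_on_cases) auto
    then show "continuous_on (S \<union> T) (\<lambda>z. (if z \<in> S then f z else g' z) i)"
      by (simp add: if_distrib[of "\<lambda>h. h i"])
  qed (use lift_on_sphere[OF lifts(1)] lift_on_sphere[OF g'(1)] lifts(1) g'(1) in \<open>auto simp: lift_on_def\<close>)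
  then show ?thesis by blast
qed

lemma lift_on_chart:
  assumes "continuous_map euclidean (real_projective_space n) H" "H ` S \<subseteq> chart n a"
  shows "lift_on n H S (\<lambda>z. representative n a (H z))"
proof -
  have "continuous_map (top_of_set S) (subtopology (real_projective_space n) (chart n a)) H"
    using assms by (auto simp: continuous_map_in_subtopology intro: continuous_map_from_subtopology)
  from continuous_map_compose[OF this continuous_map_representative]
  show ?thesis using assms(2) by (auto simp: lift_on_def o_def representative)
qed

text \<open>Two nested bisections. Near each point a rectangle is mapped into one chart; gluing in
  the second coordinate gives a narrow strip of full height, gluing strips in the first coordinate
  gives the square. Since \<open>H\<close> lives on the whole plane, the rectangles may stick out of
  the square.\<close>

lemma lift_square:
  fixes H :: "real \<times> real \<Rightarrow> (nat \<Rightarrow> real) set"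
  assumes H: "continuous_map euclidean (real_projective_space n) H"
  shows "\<exists>f. lift_on n H ({0..1} \<times> {0..1}) f"
proof (rule Bolzano[of 0 1 "\<lambda>a b. \<exists>f. lift_on n H ({a..b} \<times> {0..1}) f"])
  show "(0::real) \<le> 1" by simp
next
  fix a b c :: real
  assume "\<exists>f. lift_on n H ({a..b} \<times> {0..1}) f" "\<exists>f. lift_on n H ({b..c} \<times> {0..1}) f" "a \<le> b" "b \<le> c"
  moreover have "({a..b} \<times> {0..1}) \<union> ({b..c} \<times> {0..1::real}) = {a..c} \<times> {0..1}"
    "({a..b} \<times> {0..1}) \<inter> ({b..c} \<times> {0..1::real}) = {b} \<times> {0..1}"
    using \<open>a \<le> b\<close> \<open>b \<le> c\<close> by auto
  ultimately show "\<exists>f. lift_on n H ({a..c} \<times> {0..1}) f"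
    using lift_glue[of "{a..b} \<times> {0..1}" "{b..c} \<times> {0..1}" n H]
    by (auto simp: closed_Times connected_Times)
next
  fix x :: real
  have "\<exists>d>0. \<exists>f. lift_on n H ({x-d..x+d} \<times> {0..1}) f"
  proof (rule Bolzano[of 0 1 "\<lambda>a b. \<exists>d>0. \<exists>f. lift_on n H ({x-d..x+d} \<times> {a..b}) f"])
    fix a b c :: real
    assume "\<exists>d>0. \<exists>f. lift_on n H ({x-d..x+d} \<times> {a..b}) f"
      "\<exists>d>0. \<exists>f. lift_on n H ({x-d..x+d} \<times> {b..c}) f" and abc: "a \<le> b" "b \<le> c"
    then obtain d1 d2 f1 f2 where d: "d1 > 0" "d2 > 0" and f: "lift_on n H ({x-d1..x+d1} \<times> {a..b}) f1"
      "lift_on n H ({x-d2..x+d2} \<times> {b..c}) f2" by blast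
    define d where "d = min d1 d2"
    have d': "d > 0" "d \<le> d1" "d \<le> d2" using d by (auto simp: d_def)
    have "lift_on n H ({x-d..x+d} \<times> {a..b}) f1" "lift_on n H ({x-d..x+d} \<times> {b..c}) f2"
      using d' by (auto intro: lift_on_subset[OF f(1)] lift_on_subset[OF f(2)])
    moreover have "({x-d..x+d} \<times> {a..b}) \<union> ({x-d..x+d} \<times> {b..c}) = {x-d..x+d} \<times> {a..c}"
      "({x-d..x+d} \<times> {a..b}) \<inter> ({x-d..x+d} \<times> {b..c}) = {x-d..x+d} \<times> {b}"
      using abc by auto
    ultimately have "\<exists>f. lift_on n H ({x-d..x+d} \<times> {a..c}) f"
      using lift_glue[of "{x-d..x+d} \<times> {a..b}" "{x-d..x+d} \<times> {b..c}" n H f1 f2]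
      by (auto simp: closed_Times connected_Times)
    then show "\<exists>d>0. \<exists>f. lift_on n H ({x-d..x+d} \<times> {a..c}) f" using d' by blast
  next
    fix u :: real
    have "H (x, u) \<in> topspace (real_projective_space n)"
      using H by (auto simp: continuous_map_def)
    then obtain a where a: "a \<in> topspace (nsphere n)" "H (x, u) = antipodal_class a"
      by (auto simp: topspace_projective)
    define W where "W = {z. H z \<in> chart n a}"
    have "open W"
      using openin_continuous_map_preimage[OF H openin_chart[of n a]] by (simp add: W_def)
    moreover have "(x, u) \<in> W"
      using a by (simp add: W_def antipodal_class_in_chart_iff in_nsphere_iff)
    ultimately obtain A B where AB: "open A" "open B" "x \<in> A" "u \<in> B" "A \<times> B \<subseteq> W"
      by (rule open_prod_elim) auto
    obtain d1 d2 where d: "d1 > 0" "cball x d1 \<subseteq> A" "d2 > 0" "ball u d2 \<subseteq> B"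
      using AB by (meson open_contains_ball open_contains_cball)
    have "\<exists>f. lift_on n H ({x-d1..x+d1} \<times> {p..q}) f" if "p \<le> u" "u \<le> q" "q - p < d2" for p q
    proof -
      have "{x-d1..x+d1} \<subseteq> A" using d(2) by (simp add: cball_eq_atLeastAtMost)
      moreover have "{p..q} \<subseteq> B" using d(4) that by (force simp: ball_def dist_real_def)
      ultimately have "H ` ({x-d1..x+d1} \<times> {p..q}) \<subseteq> chart n a" using AB(5) by (auto simp: W_def)
      then show ?thesis using lift_on_chart[OF H] by blast
    qed
    then show "\<exists>d>0. \<forall>p q. p \<le> u \<and> u \<le> q \<and> q - p < d \<longrightarrow>
        (\<exists>d>0. \<exists>f. lift_on n H ({x-d..x+d} \<times> {p..q}) f)" using d by blast
  qed simp
  then obtain d f where d: "d > 0" "lift_on n H ({x-d..x+d} \<times> {0..1}) f" by blast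
  have "lift_on n H ({a..b} \<times> {0..1}) f" if "a \<le> x" "x \<le> b" "b - a < d" for a b
    using that by (intro lift_on_subset[OF d(2)]) auto
  then show "\<exists>d>0. \<forall>a b. a \<le> x \<and> x \<le> b \<and> b - a < d \<longrightarrow> (\<exists>f. lift_on n H ({a..b} \<times> {0..1}) f)"
    using d(1) by blast
qed

definition lift_joins :: "nat \<Rightarrow> (real \<Rightarrow> (nat \<Rightarrow> real) set) \<Rightarrow> real \<Rightarrow> (nat \<Rightarrow> real) \<Rightarrow> (nat \<Rightarrow> real) \<Rightarrow> bool" where
  "lift_joins n \<gamma> u x y \<longleftrightarrow> (\<exists>f. lift_on n \<gamma> {0..1} f \<and> f 0 = x \<and> f u = y)"

lemma lift_joins_neg: "lift_joins n \<gamma> u (\<lambda>i. - x i) (\<lambda>i. - y i) \<longleftrightarrow> lift_joins n \<gamma> u x y"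
proof -
  have "lift_joins n \<gamma> u (\<lambda>i. - x i) (\<lambda>i. - y i)" if "lift_joins n \<gamma> u x y" for x y
    using that lift_on_neg unfolding lift_joins_def by fastforce
  from this[of x y] this[of "\<lambda>i. - x i" "\<lambda>i. - y i"] show ?thesis by auto
qed

lemma lift_joins_unique:
  assumes "lift_joins n \<gamma> u x y" "0 \<le> u" "u \<le> 1"
  shows "\<not> lift_joins n \<gamma> u x (\<lambda>i. - y i)"
proof
  assume "lift_joins n \<gamma> u x (\<lambda>i. - y i)"
  then obtain g where g: "lift_on n \<gamma> {0..1} g" "g 0 = x" "g u = (\<lambda>i. - y i)"
    by (auto simp: lift_joins_def)
  obtain f where f: "lift_on n \<gamma> {0..1} f" "f 0 = x" "f u = y"
    using assms(1) by (auto simp: lift_joins_def)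
  have "f 0 \<noteq> (\<lambda>i. - g 0 i)" "f u \<noteq> g u"
    using lift_on_sphere[OF f(1), of 0] lift_on_sphere[OF f(1), of u] neg_neq_nsphere assms(2,3) f g
    by auto
  moreover have "(\<forall>z\<in>{0..1}. f z = g z) \<or> (\<forall>z\<in>{0..1}. f z = (\<lambda>i. - g z i))"
    using f(1) g(1) by (intro lifts_agree_up_to_sign) auto
  ultimately show False using assms(2,3) by force
qed

text \<open>A lift starting at \<open>x\<close> exists and ends over \<open>\<gamma> u\<close>;
  uniqueness excludes both ends at once. So joining is a sign that changes when one end is replaced
  by its antipode.\<close>

lemma lift_joins_flip:
  assumes "pathin (real_projective_space n) \<gamma>" "0 \<le> u" "u \<le> 1"
    and "antipodal_class x = \<gamma> 0" "antipodal_class y = \<gamma> u"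
  shows "lift_joins n \<gamma> u x (\<lambda>i. - y i) \<longleftrightarrow> \<not> lift_joins n \<gamma> u x y"
proof -
  \<comment> \<open>The path is extended to the whole line and read as a map of the plane that
    ignores the first coordinate, so that the lifting result for squares applies.\<close>
  define clamp where "clamp r = max 0 (min 1 r)" for r :: real
  have clamp: "clamp r \<in> {0..1}" for r by (auto simp: clamp_def)
  have "continuous_map euclidean (top_of_set {0..1}) (\<lambda>z::real \<times> real. clamp (snd z))"
    using clamp unfolding clamp_def by (auto simp: continuous_map_in_subtopology intro!: continuous_intros)
  from continuous_map_compose[OF this assms(1)[unfolded pathin_def]]
  have "continuous_map euclidean (real_projective_space n) (\<lambda>z::real \<times> real. \<gamma> (clamp (snd z)))"
    by (simp add: o_def)
  from lift_square[OF this]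
  obtain F where F: "lift_on n (\<lambda>z::real \<times> real. \<gamma> (clamp (snd z))) ({0..1} \<times> {0..1}) F" by blast
  define f where "f r = F (0, r)" for r
  have "lift_on n \<gamma> {0..1} f"
  proof (rule lift_onI)
    fix i
    show "continuous_on {0..1} (\<lambda>z. f z i)"
      unfolding f_def
      by (rule continuous_on_compose2[OF lift_on_continuous[OF F]]) (auto intro!: continuous_intros)
  qed (use F lift_on_sphere[OF F] in \<open>auto simp: f_def lift_on_def clamp_def\<close>)
  then have f: "\<exists>g. lift_on n \<gamma> {0..1} g \<and> g 0 = x"
  proof -
    have "antipodal_class (f 0) = antipodal_class x"
      using \<open>lift_on n \<gamma> {0..1} f\<close> assms(4) by (simp add: lift_on_def)
    then consider "f 0 = x" | "f 0 = (\<lambda>i. - x i)" by (auto simp: antipodal_class_eq_iff)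
    then show ?thesis
    proof cases
      case 1
      then show ?thesis using \<open>lift_on n \<gamma> {0..1} f\<close> by blast
    next
      case 2
      then show ?thesis
        using lift_on_neg[OF \<open>lift_on n \<gamma> {0..1} f\<close>] by (intro exI[of _ "\<lambda>z i. - f z i"]) simp
    qed
  qed
  then obtain g where g: "lift_on n \<gamma> {0..1} g" "g 0 = x" by blast
  then have "antipodal_class (g u) = antipodal_class y"
    using assms by (simp add: lift_on_def)
  then have "lift_joins n \<gamma> u x y \<or> lift_joins n \<gamma> u x (\<lambda>i. - y i)"
    using g by (auto simp: antipodal_class_eq_iff lift_joins_def)
  then show ?thesis using lift_joins_unique[OF _ assms(2,3)] by blast
qed

text \<open>One lift of the whole square restricts to lifts of all the paths
  \<open>H (t, _)\<close>. At the levels 0 and \<open>u\<close> it agrees with \<open>a\<close> and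
  \<open>b\<close> up to signs that do not depend on \<open>t\<close>.\<close>

lemma lift_joins_homotopy:
  fixes H :: "real \<times> real \<Rightarrow> (nat \<Rightarrow> real) set"
  assumes H: "continuous_map euclidean (real_projective_space n) H" and u: "0 \<le> u" "u \<le> 1"
    and a: "lift_on n (\<lambda>t. H (t, 0)) {0..1} a" and b: "lift_on n (\<lambda>t. H (t, u)) {0..1} b"
  shows "lift_joins n (\<lambda>r. H (0, r)) u (a 0) (b 0) \<longleftrightarrow> lift_joins n (\<lambda>r. H (1, r)) u (a 1) (b 1)"
proof -
  obtain F where F: "lift_on n H ({0..1} \<times> {0..1}) F" using lift_square[OF H] by blast
  have slice: "lift_on n (\<lambda>r. H (h r)) {0..1} (\<lambda>r. F (h r))"
    if "continuous_on {0..1} h" "h ` {0..1} \<subseteq> {0..1} \<times> {0..1}" for h :: "real \<Rightarrow> real \<times> real"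
  proof (rule lift_onI)
    show "continuous_on {0..1} (\<lambda>z. F (h z) i)" for i
      by (rule continuous_on_compose2[OF lift_on_continuous[OF F] that])
  qed (use F lift_on_sphere[OF F] that in \<open>force simp: lift_on_def\<close>)+
  have vert: "lift_joins n (\<lambda>r. H (t, r)) u (F (t, 0)) (F (t, u))" if "t \<in> {0..1}" for t
    unfolding lift_joins_def
    by (rule exI, rule conjI, rule slice) (use that in \<open>auto intro!: continuous_intros\<close>)
  have path: "pathin (real_projective_space n) (\<lambda>r. H (t, r))" for t
  proof -
    have "continuous_map (top_of_set {0..1}) euclidean (\<lambda>r. (t, r))"
      by (auto simp: continuous_map_iff_continuous intro!: continuous_intros)
    from continuous_map_compose[OF this H] show ?thesis by (simp add: pathin_def o_def)
  qed
  have "(\<forall>t\<in>{0..1}. F (t, r) = c t) \<or> (\<forall>t\<in>{0..1}. F (t, r) = (\<lambda>i. - c t i))"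
    if "lift_on n (\<lambda>t. H (t, r)) {0..1} c" "r \<in> {0..1}" for c r
    using that by (intro lifts_agree_up_to_sign[OF _ slice that(1)]) (auto intro!: continuous_intros)
  from this[OF a] this[OF b] u
  have signs: "(\<forall>t\<in>{0..1}. F (t, 0) = a t) \<or> (\<forall>t\<in>{0..1}. F (t, 0) = (\<lambda>i. - a t i))"
    "(\<forall>t\<in>{0..1}. F (t, u) = b t) \<or> (\<forall>t\<in>{0..1}. F (t, u) = (\<lambda>i. - b t i))" by auto
  have flip: "lift_joins n (\<lambda>r. H (t, r)) u (a t) (\<lambda>i. - b t i) \<longleftrightarrow>
      \<not> lift_joins n (\<lambda>r. H (t, r)) u (a t) (b t)" if "t \<in> {0..1}" for t
    using a b u that by (intro lift_joins_flip[OF path]) (auto simp: lift_on_def)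
  have flip': "lift_joins n (\<lambda>r. H (t, r)) u (\<lambda>i. - a t i) (b t) \<longleftrightarrow>
      lift_joins n (\<lambda>r. H (t, r)) u (a t) (\<lambda>i. - b t i)" for t
    using lift_joins_neg[of n "\<lambda>r. H (t, r)" u "a t" "\<lambda>i. - b t i"] by simp
  show ?thesis
    using signs vert[of 0] vert[of 1] flip[of 0] flip[of 1] flip'[of 0] flip'[of 1]
      lift_joins_neg[of n "\<lambda>r. H (0, r)" u "a 0" "b 0"] lift_joins_neg[of n "\<lambda>r. H (1, r)" u "a 1" "b 1"]
    by (elim disjE) simp_all
qed

section \<open>The lower bound\<close>

lemma path_space_subbasis_open:
  assumes "K \<subseteq> {0..1}" "compact K" "openin X U"
  shows "openin (path_space X) {\<gamma> \<in> paths X. \<gamma> ` K \<subseteq> U}"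
  unfolding path_space_def using assms by (intro topology_generated_by_Basis) blast

text \<open>The interval is locally compact: a compact neighbourhood of the time \<open>r\<close> is
  sent into \<open>W\<close>, and this is an open condition on the path.\<close>

lemma continuous_map_path_eval:
  assumes g: "continuous_map X (path_space Y) g"
  shows "continuous_map (prod_topology X (top_of_set {0..1})) Y (\<lambda>z. g (fst z) (snd z))"
  unfolding continuous_map_def
proof (intro conjI allI impI)
  have paths: "g x \<in> paths Y" if "x \<in> topspace X" for x
    using continuous_map_image_subset_topspace[OF g] that by auto
  show "(\<lambda>z. g (fst z) (snd z)) \<in> topspace (prod_topology X (top_of_set {0..1})) \<rightarrow> topspace Y"
    using paths by (fastforce simp: paths_def pathin_def continuous_map_def)
  fix W assume W: "openin Y W"
  show "openin (prod_topology X (top_of_set {0..1}))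
      {z \<in> topspace (prod_topology X (top_of_set {0..1})). g (fst z) (snd z) \<in> W}"
    unfolding openin_prod_topology_alt
  proof (intro allI impI)
    fix x r assume "(x, r) \<in> {z \<in> topspace (prod_topology X (top_of_set {0..1})). g (fst z) (snd z) \<in> W}"
    then have x: "x \<in> topspace X" and r: "r \<in> {0..1}" "g x r \<in> W" by auto
    have "openin (top_of_set {0..1}) {q \<in> {0..1}. g x q \<in> W}"
      using openin_continuous_map_preimage[of "top_of_set {0..1}" Y "g x" W] paths[OF x] W
      by (simp add: paths_def pathin_def)
    then obtain e where e: "e > 0" "cball r e \<inter> {0..1} \<subseteq> {q \<in> {0..1}. g x q \<in> W}"
      using r by (auto simp: openin_contains_cball)
    define B where "B = {\<gamma> \<in> paths Y. \<gamma> ` (cball r e \<inter> {0..1}) \<subseteq> W}"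
    have "openin (path_space Y) B"
      unfolding B_def by (intro path_space_subbasis_open) (auto simp: W compact_Int)
    then have "openin X {x \<in> topspace X. g x \<in> B}"
      by (rule openin_continuous_map_preimage[OF g])
    moreover have "openin (top_of_set {0..1}) ({0..1} \<inter> ball r e)" by (simp add: openin_open_Int)
    moreover have "x \<in> {x \<in> topspace X. g x \<in> B}" "r \<in> {0..1} \<inter> ball r e"
      using x r e paths[OF x] by (auto simp: B_def)
    moreover have "{x \<in> topspace X. g x \<in> B} \<times> ({0..1} \<inter> ball r e) \<subseteq>
        {z \<in> topspace (prod_topology X (top_of_set {0..1})). g (fst z) (snd z) \<in> W}"
      by (fastforce simp: B_def)
    ultimately show "\<exists>U V. openin X U \<and> openin (top_of_set {0..1}) V \<and> x \<in> U \<and> r \<in> V \<and> U \<times> V \<subseteq>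
        {z \<in> topspace (prod_topology X (top_of_set {0..1})). g (fst z) (snd z) \<in> W}" by blast
  qed
qed

section \<open>Spherical coordinates on the cube\<close>

definition spherical :: "nat \<Rightarrow> (nat \<Rightarrow> real) \<Rightarrow> nat \<Rightarrow> real" where
  "spherical n \<theta> i = (if i < n then (\<Prod>l<i. sin (\<theta> l)) * cos (\<theta> i)
     else if i = n then (\<Prod>l<n. sin (\<theta> l)) else 0)"

lemma spherical_cong: "(\<And>l. l < n \<Longrightarrow> \<theta> l = \<theta>' l) \<Longrightarrow> spherical n \<theta> = spherical n \<theta>'"
  by (auto simp: spherical_def fun_eq_iff intro!: prod.cong)

lemma spherical_in_nsphere: "spherical n \<theta> \<in> topspace (nsphere n)"
proof -
  have "(\<Sum>i<r. ((\<Prod>l<i. sin (\<theta> l)) * cos (\<theta> i)) ^ 2) + (\<Prod>l<r. sin (\<theta> l)) ^ 2 = 1" for r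
  proof (induction r)
    case (Suc r)
    have "((\<Prod>l<r. sin (\<theta> l)) * cos (\<theta> r)) ^ 2 + (\<Prod>l<Suc r. sin (\<theta> l)) ^ 2 =
        (\<Prod>l<r. sin (\<theta> l)) ^ 2 * ((cos (\<theta> r)) ^ 2 + (sin (\<theta> r)) ^ 2)"
      by (simp only: prod.lessThan_Suc power_mult_distrib distrib_left)
    also have "\<dots> = (\<Prod>l<r. sin (\<theta> l)) ^ 2" by simp
    finally show ?case using Suc.IH by simp
  qed simp
  from this[of n] have "(\<Sum>i\<le>n. (spherical n \<theta> i) ^ 2) = 1"
    by (simp add: spherical_def flip: lessThan_Suc_atMost)
  then show ?thesis by (simp add: nsphere spherical_def)
qed

text \<open>Coordinates after \<open>p\<close> contain the factor \<open>sin (\<theta> p)\<close>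
  and vanish; each coordinate up to \<open>p\<close> contains a single cosine, which changes
  sign.\<close>

lemma spherical_reflect:
  assumes "p < n" "sin (\<theta> p) = 0"
  shows "spherical n (\<lambda>l. if l \<le> p then pi - \<theta> l else \<theta> l) = (\<lambda>i. - spherical n \<theta> i)"
proof
  fix i
  let ?\<theta> = "\<lambda>l. if l \<le> p then pi - \<theta> l else \<theta> l"
  have sin: "sin (?\<theta> l) = sin (\<theta> l)" for l by simp
  have zero: "(\<Prod>l<j. sin (\<theta> l)) = 0" if "p < j" for j
    using that assms(2) by (intro prod_zero) auto
  show "spherical n ?\<theta> i = - spherical n \<theta> i"
  proof (cases "i \<le> p")
    case True
    then show ?thesis using assms(1) unfolding spherical_def sin by simp
  next
    case False
    then show ?thesis using assms(1) zero[of i] zero[of n] unfolding spherical_def sin by simp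
  qed
qed

definition block_point :: "nat \<Rightarrow> nat \<Rightarrow> (nat \<Rightarrow> real) \<Rightarrow> nat \<Rightarrow> real" where
  "block_point n i y = spherical n (\<lambda>l. pi * y (i * n + l))"

definition box_map :: "nat \<Rightarrow> nat \<Rightarrow> (nat \<Rightarrow> real) \<Rightarrow> nat \<Rightarrow> (nat \<Rightarrow> real) set" where
  "box_map n k y = (\<lambda>i\<in>{..<k}. antipodal_class (block_point n i y))"

lemma block_point_in_nsphere: "block_point n i y \<in> topspace (nsphere n)"
  unfolding block_point_def by (rule spherical_in_nsphere)

lemma block_point_reflect:
  assumes "n > 0" "y p \<in> {0, 1}"
  shows "block_point n i (reflect n 1 p y) =
    (if i = p div n then (\<lambda>j. - block_point n i y j) else block_point n i y)"
proof (cases "i = p div n")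
  case True
  have "block_point n i (reflect n 1 p y) =
      spherical n (\<lambda>l. if l \<le> p mod n then pi - pi * y (i * n + l) else pi * y (i * n + l))"
    unfolding block_point_def
  proof (rule spherical_cong)
    fix l assume l: "l < n"
    have "i * n + l \<le> p \<longleftrightarrow> l \<le> p mod n"
      unfolding True using div_mult_mod_eq[of p n] by linarith
    then show "pi * reflect n 1 p y (i * n + l) =
        (if l \<le> p mod n then pi - pi * y (i * n + l) else pi * y (i * n + l))"
      using l True by (simp add: reflect_def algebra_simps)
  qed
  also have "\<dots> = (\<lambda>j. - block_point n i y j)"
    unfolding block_point_def
  proof (rule spherical_reflect)
    have "i * n + p mod n = p" using True by simp
    then show "sin (pi * y (i * n + p mod n)) = 0" using assms(2) by auto
  qed (use assms in simp)
  finally show ?thesis using True by simp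
next
  case False
  have "block_point n i (reflect n 1 p y) = block_point n i y"
    unfolding block_point_def by (rule spherical_cong) (use False in \<open>simp add: reflect_def\<close>)
  then show ?thesis using False by simp
qed

lemma box_map_reflect:
  assumes "n > 0" "y p \<in> {0, 1}"
  shows "box_map n k (reflect n 1 p y) = box_map n k y"
  unfolding box_map_def by (intro restrict_ext) (simp add: block_point_reflect[of n y p, OF assms])

lemma continuous_block_point: "continuous_on UNIV (\<lambda>y. block_point n i y j)"
  unfolding block_point_def spherical_def
  by (cases "j < n"; cases "j = n") (auto intro!: continuous_intros)

lemma continuous_map_block_point: "continuous_map euclidean (nsphere n) (block_point n i)"
  unfolding continuous_map_nsphere_iff
  using continuous_block_point block_point_in_nsphere by auto

lemma continuous_map_box_map:
  "continuous_map euclidean (power_space k (real_projective_space n)) (box_map n k)"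
  unfolding power_space_def continuous_map_componentwise
proof (intro conjI ballI)
  fix i assume "i \<in> {..<k}"
  then have "(\<lambda>y. box_map n k y i) = antipodal_class \<circ> block_point n i"
    by (auto simp: box_map_def)
  then show "continuous_map euclidean (real_projective_space n) (\<lambda>y. box_map n k y i)"
    using continuous_map_compose[OF continuous_map_block_point continuous_map_antipodal_class] by simp
qed (auto simp: box_map_def)

section \<open>From a cover with sections to twisted functions on a fine grid\<close>

lemma cube_cover_mesh:
  fixes W :: "nat \<Rightarrow> (nat \<Rightarrow> real) set"
  assumes "\<And>t. t < M \<Longrightarrow> open (W t)" "(\<Union>t<M. W t) = UNIV"
  shows "\<exists>m>0. \<forall>y. (\<forall>p<N. 0 \<le> y p \<and> y p \<le> 1) \<and> (\<forall>p\<ge>N. y p = 0) \<longrightarrow>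
    (\<exists>t<M. \<forall>z. (\<forall>p. \<bar>z p - y p\<bar> \<le> 1 / (2 * real m)) \<longrightarrow> z \<in> W t)"
proof -
  define Q :: "(nat \<Rightarrow> real) set" where "Q = PiE UNIV (\<lambda>p. if p < N then {0..1} else {0})"
  have "compactin (product_topology (\<lambda>i. euclidean) UNIV) Q"
    unfolding Q_def compactin_PiE by auto
  then have "compact Q" by (simp add: euclidean_product_topology)
  then obtain e where e: "e > 0" "\<And>y. y \<in> Q \<Longrightarrow> \<exists>B\<in>W ` {..<M}. ball y e \<subseteq> B"
    using Heine_Borel_lemma[of Q "W ` {..<M}"] assms by auto
  \<comment> \<open>The distance of two sequences is at most twice the largest difference among
    finitely many coordinates plus the tail \<open>(1/2) ^ L\<close>; each part is kept below
    \<open>e / 2\<close>.\<close>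
  obtain L where L: "(1/2) ^ L < e / 2" using e(1) real_arch_pow_inv[of "e / 2" "1/2"] by auto
  obtain m :: nat where m: "2 / e < real m" using reals_Archimedean2 by blast
  have m0: "m > 0" using m e(1) by (metis divide_pos_pos not_gr0 of_nat_0 order_less_asym zero_less_numeral)
  have near: "dist y z < e" if "\<forall>p. \<bar>z p - y p\<bar> \<le> 1 / (2 * real m)" for y z :: "nat \<Rightarrow> real"
  proof -
    have "Max {dist (y (from_nat n)) (z (from_nat n)) |n. n \<le> L} \<le> 1 / (2 * real m)"
    proof (rule Max.boundedI)
      show "finite {dist (y (from_nat n)) (z (from_nat n)) |n. n \<le> L}"
        using finite_image_set[of "\<lambda>n. n \<le> L" "\<lambda>n. dist (y (from_nat n)) (z (from_nat n))"] by simp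
    qed (use that in \<open>auto simp: dist_real_def abs_minus_commute\<close>)
    then have "dist y z \<le> 2 * (1 / (2 * real m)) + (1/2) ^ L"
      using dist_fun_le_dist_first_terms[of y z L] by linarith
    also have "2 * (1 / (2 * real m)) = 1 / real m" using m0 by simp
    also have "1 / real m < e / 2" using m m0 e(1) by (simp add: field_simps)
    finally show ?thesis using L by simp
  qed
  have "\<exists>t<M. \<forall>z. (\<forall>p. \<bar>z p - y p\<bar> \<le> 1 / (2 * real m)) \<longrightarrow> z \<in> W t"
    if "(\<forall>p<N. 0 \<le> y p \<and> y p \<le> 1) \<and> (\<forall>p\<ge>N. y p = 0)" for y
  proof -
    have "y \<in> Q" using that by (auto simp: Q_def)
    then obtain t where "t < M" "ball y e \<subseteq> W t" using e(2) by blast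
    then show ?thesis using near
      by (meson mem_ball subsetD)
  qed
  then show ?thesis using m0 by blast
qed

text \<open>A discontinuous choice between each point and its antipode. It supplies values where no
  section is available.\<close>

definition sphere_sign :: "(nat \<Rightarrow> real) \<Rightarrow> bit" where
  "sphere_sign x = of_bool (x (LEAST i. x i \<noteq> 0) > 0)"

lemma sphere_sign_neg:
  assumes "x \<in> topspace (nsphere n)"
  shows "sphere_sign (\<lambda>i. - x i) = sphere_sign x + 1"
proof -
  have "\<exists>i. x i \<noteq> 0"
  proof (rule ccontr)
    assume "\<nexists>i. x i \<noteq> 0"
    then have "x = (\<lambda>i. - x i)" by auto
    then show False using neg_neq_nsphere[OF assms] by blast
  qed
  then have "x (LEAST i. x i \<noteq> 0) \<noteq> 0" by (rule LeastI_ex)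
  then show ?thesis by (auto simp: sphere_sign_def)
qed

lemma section_path:
  assumes s: "continuous_map (subtopology (power_space k X) U) (path_space X) s"
    and sec: "\<forall>x\<in>U. path_eval k (s x) = x" and x: "x \<in> U" "x \<in> topspace (power_space k X)"
    and j: "j < k" "k \<ge> 2"
  shows "pathin X (s x)" "s x (real j / (real k - 1)) = x j" "real j / (real k - 1) \<in> {0..1}"
proof -
  have "s x \<in> paths X"
    using continuous_map_image_subset_topspace[OF s] x by auto
  then show "pathin X (s x)" by (simp add: paths_def)
  have "path_eval k (s x) j = x j" using sec x by simp
  then show "s x (real j / (real k - 1)) = x j" using j by (simp add: path_eval_def)
  show "real j / (real k - 1) \<in> {0..1}" using j by (auto simp: divide_le_eq)
qed

lemma no_small_section_cover:
  fixes V :: "nat \<Rightarrow> (nat \<Rightarrow> (nat \<Rightarrow> real) set) set"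
  assumes n: "n > 0" and k: "k \<ge> 2"
    and V: "\<And>t. t < k * n \<Longrightarrow> openin (power_space k (real_projective_space n)) (V t)"
    and sec: "\<And>t. t < k * n \<Longrightarrow> admits_section k (real_projective_space n) (V t)"
    and cover: "(\<Union>t<k * n. V t) = topspace (power_space k (real_projective_space n))"
    and J: "\<And>t. t < k * n \<Longrightarrow> J t \<in> {1..<k}"
    and odd: "\<And>j. j \<in> {1..<k} \<Longrightarrow> odd (card {t. t < k * n \<and> J t = j} choose n)"
  shows False
proof -
  let ?P = "real_projective_space n"
  let ?X = "power_space k ?P"
  define \<Phi> where "\<Phi> = box_map n k"
  have \<Phi>: "continuous_map euclidean ?X \<Phi>" unfolding \<Phi>_def by (rule continuous_map_box_map)
  have \<Phi>_top: "\<Phi> y \<in> topspace ?X" for y using \<Phi> by (auto simp: continuous_map_def)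
  have \<Phi>_apply: "\<Phi> y i = antipodal_class (block_point n i y)" if "i < k" for y i
    using that by (simp add: \<Phi>_def box_map_def)
  obtain s where s: "\<And>t. t < k * n \<Longrightarrow> continuous_map (subtopology ?X (V t)) (path_space ?P) (s t)"
    "\<And>t. t < k * n \<Longrightarrow> \<forall>x\<in>V t. path_eval k (s t x) = x"
    using sec unfolding admits_section_def by metis
  define W where "W t = {y. \<Phi> y \<in> V t}" for t
  have W_open: "open (W t)" if "t < k * n" for t
    using openin_continuous_map_preimage[OF \<Phi> V[OF that]] by (simp add: W_def)
  have W_cover: "(\<Union>t<k * n. W t) = UNIV" using \<Phi>_top cover by (auto simp: W_def)
  have "\<exists>m>0. \<forall>y. (\<forall>p<k * n. 0 \<le> y p \<and> y p \<le> 1) \<and> (\<forall>p\<ge>k * n. y p = 0) \<longrightarrow>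
      (\<exists>t<k * n. \<forall>z. (\<forall>p. \<bar>z p - y p\<bar> \<le> 1 / (2 * real m)) \<longrightarrow> z \<in> W t)"
    by (rule cube_cover_mesh[OF W_open W_cover])
  then obtain m where m: "m > 0" and mesh: "\<forall>y. (\<forall>p<k * n. 0 \<le> y p \<and> y p \<le> 1) \<and>
      (\<forall>p\<ge>k * n. y p = 0) \<longrightarrow> (\<exists>t<k * n. \<forall>z. (\<forall>p. \<bar>z p - y p\<bar> \<le> 1 / (2 * real m)) \<longrightarrow> z \<in> W t)"
    by (elim exE conjE)
  define u where "u t = real (J t) / (real k - 1)" for t
  define crosses where "crosses t y \<longleftrightarrow>
    lift_joins n (s t (\<Phi> y)) (u t) (block_point n 0 y) (block_point n (J t) y)" for t y
  \<comment> \<open>Outside \<open>W t\<close> there is no path to lift. The default value changes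
    in the same way when the point of block 0 or of block \<open>J t\<close> is negated, so the
    twist law holds at every point of the grid.\<close>
  define \<sigma> where "\<sigma> t y = (if y \<in> W t then of_bool (crosses t y)
    else sphere_sign (block_point n 0 y) + sphere_sign (block_point n (J t) y))" for t y
  define \<omega> :: "nat \<Rightarrow> nat \<Rightarrow> bit" where "\<omega> t i = of_bool (i = 0 \<or> i = J t)" for t i
  have sec_path: "pathin ?P (s t (\<Phi> y))" "s t (\<Phi> y) 0 = antipodal_class (block_point n 0 y)"
    "s t (\<Phi> y) (u t) = antipodal_class (block_point n (J t) y)" "0 \<le> u t" "u t \<le> 1"
    if t: "t < k * n" and y: "y \<in> W t" for t y
  proof -
    have "\<Phi> y \<in> V t" using y by (simp add: W_def)
    note * = section_path[OF s(1,2)[OF t] this \<Phi>_top]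
    show "pathin ?P (s t (\<Phi> y))" "s t (\<Phi> y) 0 = antipodal_class (block_point n 0 y)"
      using *[of 0] k by (simp_all add: \<Phi>_apply)
    show "s t (\<Phi> y) (u t) = antipodal_class (block_point n (J t) y)" "0 \<le> u t" "u t \<le> 1"
      using *[of "J t"] k J[OF t] by (simp_all add: \<Phi>_apply u_def)
  qed
  have \<sigma>_reflect: "\<sigma> t (reflect n 1 p y) = \<sigma> t y + \<omega> t (p div n)"
    if t: "t < k * n" and p: "y p \<in> {0, 1}" for t p y
  proof -
    have \<Phi>r: "\<Phi> (reflect n 1 p y) = \<Phi> y" unfolding \<Phi>_def by (rule box_map_reflect[of n y p, OF n p])
    have W: "reflect n 1 p y \<in> W t \<longleftrightarrow> y \<in> W t" by (simp add: W_def \<Phi>r)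
    note bp = block_point_reflect[of n y p, OF n p]
    have J0: "J t \<noteq> 0" using J[OF t] by auto
    show ?thesis
    proof (cases "y \<in> W t")
      case True
      have flip: "lift_joins n (s t (\<Phi> y)) (u t) (block_point n 0 y) (\<lambda>i. - block_point n (J t) y i) \<longleftrightarrow>
          \<not> crosses t y"
        unfolding crosses_def using sec_path[OF t True] by (intro lift_joins_flip) auto
      then have flip0: "lift_joins n (s t (\<Phi> y)) (u t) (\<lambda>i. - block_point n 0 y i) (block_point n (J t) y) \<longleftrightarrow>
          \<not> crosses t y"
        using lift_joins_neg[of n "s t (\<Phi> y)" "u t" "block_point n 0 y" "\<lambda>i. - block_point n (J t) y i"] by simp
      have "crosses t (reflect n 1 p y) \<longleftrightarrow> (crosses t y \<longleftrightarrow> \<not> (p div n = 0 \<or> p div n = J t))"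
        unfolding crosses_def[of t "reflect n 1 p y"] \<Phi>r bp
        using J0 flip flip0 crosses_def[of t y] by auto
      then show ?thesis using True W by (auto simp: \<sigma>_def \<omega>_def)
    next
      case False
      then show ?thesis using J0 W
        by (auto simp: \<sigma>_def \<omega>_def bp sphere_sign_neg[OF block_point_in_nsphere] add_ac)
    qed
  qed
  \<comment> \<open>Neighbouring grid points are \<open>1 / (2 * real m)\<close> apart, which is the
    radius granted by \<open>mesh\<close>.\<close>
  define scale where "scale v = (\<lambda>p. real_of_int (v p) / (2 * real m))" for v :: "nat \<Rightarrow> int"
  have "twisted_box n k (int m) (\<lambda>t v. \<sigma> t (scale v)) \<omega>"
  proof
    fix t p and v :: "nat \<Rightarrow> int"
    assume t: "t < k * n" and v: "v p \<in> {0, 2 * int m}"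
    have "scale (reflect n (2 * int m) p v) = reflect n 1 p (scale v)"
      using m by (auto simp: scale_def reflect_def fun_eq_iff diff_divide_distrib)
    moreover have "scale v p \<in> {0, 1}" using v m by (auto simp: scale_def)
    ultimately show "\<sigma> t (scale (reflect n (2 * int m) p v)) = \<sigma> t (scale v) + \<omega> t (p div n)"
      using \<sigma>_reflect[OF t] by simp
  qed (use n m in auto)
  then interpret twisted_box n k "int m" "\<lambda>t v. \<sigma> t (scale v)" \<omega> .
  obtain v where v: "\<forall>p<k * n. 0 < v p \<and> v p < 2 * int m" "\<forall>p\<ge>k * n. v p = 0"
    and non: "\<forall>t<k * n. \<exists>u. face (k * n) u v \<and> \<sigma> t (scale u) \<noteq> \<sigma> t (scale v)"
    using nonconstant_class[of J, OF _ J odd] by (auto simp: \<omega>_def)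
  have "\<forall>p<k * n. 0 \<le> scale v p \<and> scale v p \<le> 1"
    using v(1) m by (auto simp: scale_def divide_le_eq)
  moreover have "\<forall>p\<ge>k * n. scale v p = 0" using v(2) by (simp add: scale_def)
  ultimately have "\<exists>t<k * n. \<forall>z. (\<forall>p. \<bar>z p - scale v p\<bar> \<le> 1 / (2 * real m)) \<longrightarrow> z \<in> W t"
    using mesh[rule_format, of "scale v"] by simp
  then obtain t where t: "t < k * n"
    and near: "\<And>z. (\<And>p. \<bar>z p - scale v p\<bar> \<le> 1 / (2 * real m)) \<Longrightarrow> z \<in> W t"
    by blast
  obtain w where w: "face (k * n) w v" "\<sigma> t (scale w) \<noteq> \<sigma> t (scale v)" using non t by blast
  \<comment> \<open>The segment from the centre of the cell to a face on which the sign differs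
    stays inside \<open>W t\<close>. The section turns it into a homotopy of paths, along which the
    sign cannot change.\<close>
  define z where "z r = (\<lambda>p. (1 - r) * scale v p + r * scale w p)" for r
  define clamp where "clamp r = max 0 (min 1 r)" for r :: real
  have clamp: "clamp r \<in> {0..1}" for r by (auto simp: clamp_def)
  have zW: "z r \<in> W t" if "r \<in> {0..1}" for r
  proof (rule near)
    fix p
    have "z r p - scale v p = r * (real_of_int (w p - v p) / (2 * real m))"
      by (simp add: z_def scale_def algebra_simps diff_divide_distrib)
    also have "\<bar>\<dots>\<bar> \<le> 1 * (1 / (2 * real m))"
      unfolding abs_mult
    proof (rule mult_mono)
      have "\<bar>w p - v p\<bar> \<le> 1" using w(1) by (auto simp: face_def dest: spec[of _ p])
      then have "\<bar>real_of_int (w p - v p)\<bar> \<le> 1" by linarith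
      then show "\<bar>real_of_int (w p - v p) / (2 * real m)\<bar> \<le> 1 / (2 * real m)"
        using m by (simp add: divide_right_mono)
    qed (use that in auto)
    finally show "\<bar>z r p - scale v p\<bar> \<le> 1 / (2 * real m)" by simp
  qed
  define H where "H q = s t (\<Phi> (z (clamp (fst q)))) (clamp (snd q))" for q :: "real \<times> real"
  have cz: "continuous_map X euclidean (\<lambda>x. z (h x))" if "continuous_map X euclideanreal h" for X and h :: "'b \<Rightarrow> real"
    unfolding euclidean_product_topology[symmetric] continuous_map_componentwise_UNIV z_def
    using that by (intro allI continuous_map_add continuous_map_real_mult continuous_map_diff) auto
  have cclamp: "continuous_map euclidean euclideanreal (\<lambda>q. clamp (h q))"
    if "continuous_on UNIV h" for h :: "real \<times> real \<Rightarrow> real"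
    using that unfolding clamp_def by (auto intro!: continuous_intros)
  have H: "continuous_map euclidean ?P H"
  proof -
    have "continuous_map euclidean (subtopology ?X (V t)) (\<lambda>q::real \<times> real. \<Phi> (z (clamp (fst q))))"
      unfolding continuous_map_in_subtopology
    proof
      show "continuous_map euclidean ?X (\<lambda>q::real \<times> real. \<Phi> (z (clamp (fst q))))"
        using continuous_map_compose[OF cz[OF cclamp[of fst]] \<Phi>] by (simp add: o_def continuous_on_fst)
    qed (use zW clamp in \<open>auto simp: W_def\<close>)
    moreover have "continuous_map euclidean (top_of_set {0..1}) (\<lambda>q::real \<times> real. clamp (snd q))"
      using cclamp[of snd] clamp by (auto simp: continuous_map_in_subtopology continuous_on_snd)
    ultimately have "continuous_map euclidean (prod_topology (subtopology ?X (V t)) (top_of_set {0..1}))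
        (\<lambda>q::real \<times> real. (\<Phi> (z (clamp (fst q))), clamp (snd q)))"
      by (rule continuous_map_pairedI)
    from continuous_map_compose[OF this continuous_map_path_eval[OF s(1)[OF t]]]
    show ?thesis by (simp add: o_def H_def[abs_def])
  qed
  have H_eq: "H (r, q) = s t (\<Phi> (z r)) q" if "r \<in> {0..1}" "q \<in> {0..1}" for r q
    using that by (simp add: H_def clamp_def)
  have u: "0 \<le> u t" "u t \<le> 1" using sec_path[OF t zW[of 0]] by auto
  have lift: "lift_on n (\<lambda>r. H (r, q)) {0..1} (\<lambda>r. block_point n i (z r))"
    if "i < k" "q \<in> {0..1}" "\<And>r. r \<in> {0..1} \<Longrightarrow> s t (\<Phi> (z r)) q = antipodal_class (block_point n i (z r))" for i q
  proof (rule lift_onI)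
    fix j
    have "continuous_map (top_of_set {0..1}) euclidean z"
      using cz[of "top_of_set {0..1}" "\<lambda>r. r"] by simp
    from continuous_map_compose[OF this continuous_map_block_point]
    have "continuous_map (top_of_set {0..1}) (nsphere n) (\<lambda>r. block_point n i (z r))" by (simp add: o_def)
    then show "continuous_on {0..1} (\<lambda>r. block_point n i (z r) j)"
      by (simp add: continuous_map_nsphere_iff continuous_map_iff_continuous)
  qed (use that block_point_in_nsphere H_eq in auto)
  have "lift_joins n (\<lambda>r. H (0, r)) (u t) (block_point n 0 (z 0)) (block_point n (J t) (z 0)) \<longleftrightarrow>
      lift_joins n (\<lambda>r. H (1, r)) (u t) (block_point n 0 (z 1)) (block_point n (J t) (z 1))"
    using sec_path[OF t zW] u J[OF t] k by (intro lift_joins_homotopy[OF H u] lift) auto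
  moreover have "lift_joins n (\<lambda>r. H (q, r)) (u t) x y \<longleftrightarrow> lift_joins n (s t (\<Phi> (z q))) (u t) x y"
    if "q \<in> {0..1}" for q x y
    unfolding lift_joins_def lift_on_def using H_eq[OF that] by auto
  ultimately have "crosses t (z 0) \<longleftrightarrow> crosses t (z 1)" by (simp add: crosses_def)
  moreover have "z 0 = scale v" "z 1 = scale w" by (auto simp: z_def)
  ultimately have "\<sigma> t (scale v) = \<sigma> t (scale w)"
    using zW[of 0] zW[of 1] by (simp add: \<sigma>_def)
  then show False using w(2) by simp
qed

lemma exists_with_fibre_cards:
  fixes a :: "nat \<Rightarrow> nat"
  shows "\<exists>J. (\<forall>j\<in>{1..<k}. card {t. t < (\<Sum>j\<in>{1..<k}. a j) \<and> J t = j} = a j) \<and>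
    (\<forall>t<(\<Sum>j\<in>{1..<k}. a j). J t \<in> {1..<k})"
proof (induction k)
  case (Suc k)
  define S where "S = (\<Sum>j\<in>{1..<k}. a j)"
  from Suc obtain J where J: "\<And>j. j \<in> {1..<k} \<Longrightarrow> card {t. t < S \<and> J t = j} = a j"
    "\<And>t. t < S \<Longrightarrow> J t \<in> {1..<k}" unfolding S_def by blast
  show ?case
  proof (cases "k = 0")
    case False
    then have sum: "(\<Sum>j\<in>{1..<Suc k}. a j) = S + a k" by (simp add: S_def)
    define J' where "J' t = (if t < S then J t else k)" for t
    have old: "{t. t < S + a k \<and> J' t = j} = {t. t < S \<and> J t = j}" if "j \<in> {1..<k}" for j
      using that by (auto simp: J'_def)
    have new: "{t. t < S + a k \<and> J' t = k} = {S..<S + a k}"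
    proof -
      have "J t \<noteq> k" if "t < S" for t using J(2)[OF that] by simp
      then show ?thesis by (auto simp: J'_def)
    qed
    have "card {t. t < S + a k \<and> J' t = j} = a j" if "j \<in> {1..<Suc k}" for j
    proof (cases "j = k")
      case True
      then show ?thesis by (simp add: new)
    next
      case False
      then have "j \<in> {1..<k}" using that by auto
      then show ?thesis using old J(1) by simp
    qed
    moreover have "J' t \<in> {1..<Suc k}" for t
      using J(2)[of t] False by (auto simp: J'_def)
    ultimately show ?thesis unfolding sum by blast
  qed simp
qed simp

lemma TC_projective_ge:
  assumes "even n" "k \<ge> 2" "k \<ge> 2 ^ (longest_ones n + 1) - 1"
  shows "enat (k * n) \<le> TC k (real_projective_space n)"
  unfolding TC_def
proof (rule Inf_greatest)
  let ?P = "real_projective_space n"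
  let ?X = "power_space k ?P"
  fix e assume "e \<in> {enat m |m. \<exists>U. (\<forall>i\<le>m. openin ?X (U i) \<and> admits_section k ?P (U i)) \<and>
      (\<Union>i\<le>m. U i) = topspace ?X}"
  then obtain m U where e: "e = enat m" and U: "\<And>i. i \<le> m \<Longrightarrow> openin ?X (U i) \<and> admits_section k ?P (U i)"
    "(\<Union>i\<le>m. U i) = topspace ?X" by blast
  show "enat (k * n) \<le> e"
  proof (rule ccontr)
    assume "\<not> enat (k * n) \<le> e"
    then have m: "m < k * n" by (simp add: e)
    then have n: "n > 0" by (cases n) auto
    have "2 ^ (longest_ones n + 1) - 2 \<le> k - 1" using assms(3) by linarith
    from disjoint_decomposition[OF assms(1) this]
    obtain b where b: "(\<Sum>j<k - 1. b j) = n" "\<And>j. j < k - 1 \<Longrightarrow> and n (b j) = 0" by blast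
    \<comment> \<open>The number of factors w_0 + w_j. The total \<open>(k - 1) * n + n\<close> is
      the dimension \<open>k * n\<close>.\<close>
    define a where "a j = n + b (j - 1)" for j
    have "(\<Sum>j\<in>{1..<k}. a j) = (\<Sum>j<k - 1. n + b j)"
      unfolding a_def by (rule sum.reindex_bij_witness[of _ Suc "\<lambda>j. j - 1"]) auto
    also have "\<dots> = (k - 1) * n + n" unfolding sum.distrib b(1) by simp
    also have "\<dots> = k * n" using assms(2) by (simp add: diff_mult_distrib)
    finally have sum_a: "(\<Sum>j\<in>{1..<k}. a j) = k * n" .
    obtain J where J: "\<And>j. j \<in> {1..<k} \<Longrightarrow> card {t. t < k * n \<and> J t = j} = a j"
      "\<And>t. t < k * n \<Longrightarrow> J t \<in> {1..<k}"
      using exists_with_fibre_cards[of k a] unfolding sum_a by blast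
    have odd: "odd (card {t. t < k * n \<and> J t = j} choose n)" if "j \<in> {1..<k}" for j
      unfolding J(1)[OF that] a_def using b(2)[of "j - 1"] that by (intro odd_binomial_of_disjoint) auto
    \<comment> \<open>A smaller cover is padded by repeating its last set, so that there is one set
      for each factor.\<close>
    define V where "V t = U (min t m)" for t
    have "(\<Union>t<k * n. V t) = (\<Union>i\<le>m. U i)"
    proof
      show "(\<Union>i\<le>m. U i) \<subseteq> (\<Union>t<k * n. V t)"
        using m by (force simp: V_def min_def)
    next
      have "min t m \<le> m" for t by simp
      then show "(\<Union>t<k * n. V t) \<subseteq> (\<Union>i\<le>m. U i)" unfolding V_def by blast
    qed
    then have cover: "(\<Union>t<k * n. V t) = topspace ?X" using U(2) by simp
    have V: "openin ?X (V t)" "admits_section k ?P (V t)" for t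
      using U(1)[of "min t m"] by (simp_all add: V_def)
    show False
      by (rule no_small_section_cover[OF n assms(2) V cover J(2) odd])
  qed
qed

section \<open>The upper bound\<close>

text \<open>By the tube lemma, if the compact set \<open>K\<close> of times is sent into
  \<open>U\<close> for one \<open>x\<close>, this remains true for all nearby points.\<close>

lemma continuous_map_curry_path:
  assumes h: "continuous_map (prod_topology X (top_of_set {0..1})) Y h"
  shows "continuous_map X (path_space Y) (\<lambda>x. \<lambda>r\<in>{0..1}. h (x, r))"
  unfolding path_space_def
proof (rule continuous_on_generated_topo)
  let ?B = "{{\<gamma> \<in> paths Y. \<gamma> ` K \<subseteq> U} |K U. K \<subseteq> {0..1} \<and> compact K \<and> openin Y U}"
  have paths: "(\<lambda>r\<in>{0..1}. h (x, r)) \<in> paths Y" if "x \<in> topspace X" for x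
  proof -
    have "continuous_map (top_of_set {0..1}) (prod_topology X (top_of_set {0..1})) (\<lambda>r. (x, r))"
      using that by (intro continuous_map_pairedI) auto
    from continuous_map_compose[OF this h]
    have "continuous_map (top_of_set {0..1}) Y (\<lambda>r\<in>{0..1}. h (x, r))"
      by (rule continuous_map_eq) auto
    then show ?thesis by (simp add: paths_def pathin_def)
  qed
  have "paths Y \<in> ?B"
    by (rule CollectI, rule exI[of _ "{}"], rule exI[of _ "topspace Y"]) simp
  then show "(\<lambda>x. \<lambda>r\<in>{0..1}. h (x, r)) ` topspace X \<subseteq> \<Union> ?B" using paths by blast
  fix B assume "B \<in> ?B"
  then obtain K U where B: "B = {\<gamma> \<in> paths Y. \<gamma> ` K \<subseteq> U}" and K: "K \<subseteq> {0..1}" "compact K"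
    and U: "openin Y U" by blast
  let ?W = "{z \<in> topspace (prod_topology X (top_of_set {0..1})). h z \<in> U}"
  have W: "openin (prod_topology X (top_of_set {0..1})) ?W"
    by (rule openin_continuous_map_preimage[OF h U])
  have "(\<lambda>x. \<lambda>r\<in>{0..1}. h (x, r)) -` B \<inter> topspace X = {x \<in> topspace X. \<forall>r\<in>K. h (x, r) \<in> U}"
    using paths K(1) by (auto simp: B image_subset_iff subset_iff)
  also have "openin X \<dots>"
  proof (subst openin_subopen, rule ballI)
    fix x assume x: "x \<in> {x \<in> topspace X. \<forall>r\<in>K. h (x, r) \<in> U}"
    have "compactin (top_of_set {0..1}) K" using K by (simp add: compactin_subtopology)
    moreover have "{x} \<times> K \<subseteq> ?W" using x K(1) by auto
    ultimately obtain A C where "openin X A" "x \<in> A" "K \<subseteq> C" "A \<times> C \<subseteq> ?W"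
      using tube_lemma_right[OF W, of K x] x by auto
    then show "\<exists>T. openin X T \<and> x \<in> T \<and> T \<subseteq> {x \<in> topspace X. \<forall>r\<in>K. h (x, r) \<in> U}"
      using openin_subset[of X A] by (intro exI[of _ A]) auto
  qed
  finally show "openin X ((\<lambda>x. \<lambda>r\<in>{0..1}. h (x, r)) -` B \<inter> topspace X)" .
qed

text \<open>Disjoint open pieces impose no compatibility, so a whole family of cells costs only one
  set of the cover.\<close>

lemma admits_section_disjoint_Union:
  assumes T: "\<And>i. i \<in> I \<Longrightarrow> openin (power_space k X) (T i)"
    and sec: "\<And>i. i \<in> I \<Longrightarrow> admits_section k X (T i)"
    and disj: "\<And>i j. i \<in> I \<Longrightarrow> j \<in> I \<Longrightarrow> i \<noteq> j \<Longrightarrow> T i \<inter> T j = {}"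
  shows "admits_section k X (\<Union>i\<in>I. T i)"
proof -
  let ?U = "\<Union>i\<in>I. T i"
  obtain s where s: "\<And>i. i \<in> I \<Longrightarrow> continuous_map (subtopology (power_space k X) (T i)) (path_space X) (s i)"
    "\<And>i. i \<in> I \<Longrightarrow> \<forall>x\<in>T i. path_eval k (s i x) = x"
    using sec unfolding admits_section_def by metis
  define idx where "idx x = (SOME i. i \<in> I \<and> x \<in> T i)" for x
  have idx: "idx x = i" if "i \<in> I" "x \<in> T i" for i x
  proof -
    have "idx x \<in> I \<and> x \<in> T (idx x)" unfolding idx_def using that by (intro someI) auto
    then show ?thesis using disj that by blast
  qed
  have "continuous_map (subtopology (power_space k X) ?U) (path_space X) (\<lambda>x. s (idx x) x)"
  proof (rule pasting_lemma[where I = I and T = T and f = s])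
    fix i assume i: "i \<in> I"
    show "openin (subtopology (power_space k X) ?U) (T i)"
      using T[OF i] i by (auto simp: openin_subtopology)
    have "?U \<inter> T i = T i" using i by auto
    then show "continuous_map (subtopology (subtopology (power_space k X) ?U) (T i)) (path_space X) (s i)"
      using s(1)[OF i] by (simp add: subtopology_subtopology)
  next
    fix i j x assume "i \<in> I" "j \<in> I" "x \<in> topspace (subtopology (power_space k X) ?U) \<inter> T i \<inter> T j"
    then show "s i x = s j x" using disj by (cases "i = j") auto
  next
    fix x assume "x \<in> topspace (subtopology (power_space k X) ?U)"
    then obtain i where "i \<in> I" "x \<in> T i" by auto
    then show "\<exists>j. j \<in> I \<and> x \<in> T j \<and> s (idx x) x = s j x" using idx by blast
  qed
  moreover have "path_eval k (s (idx x) x) = x" if "x \<in> ?U" for x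
    using that s(2) idx by auto
  ultimately show ?thesis unfolding admits_section_def by blast
qed

section \<open>Paths through prescribed points of affine charts\<close>

definition coord_abs :: "nat \<Rightarrow> (nat \<Rightarrow> real) set \<Rightarrow> real" where
  "coord_abs i c = \<bar>(SOME x. x \<in> c) i\<bar>"

lemma coord_abs_antipodal_class [simp]: "coord_abs i (antipodal_class x) = \<bar>x i\<bar>"
proof -
  have "(SOME y. y \<in> antipodal_class x) \<in> antipodal_class x"
    by (rule someI[of _ x]) (simp add: antipodal_class_def)
  then show ?thesis by (auto simp: coord_abs_def antipodal_class_def)
qed

lemma continuous_map_coord_abs: "continuous_map (real_projective_space n) euclideanreal (coord_abs i)"
proof (rule continuous_compose_quotient_map[OF quotient_map_projective])
  show "continuous_map (nsphere n) euclideanreal (coord_abs i \<circ> antipodal_class)"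
    using continuous_map_nsphere_projection by (simp add: o_def continuous_map_real_abs)
qed

definition basis_vec :: "nat \<Rightarrow> nat \<Rightarrow> real" where
  "basis_vec i = (\<lambda>j. of_bool (j = i))"

lemma ip_basis_vec: "i \<le> n \<Longrightarrow> ip n x (basis_vec i) = x i"
  by (simp add: ip_def basis_vec_def of_bool_def if_distrib[of "\<lambda>a. _ * a"] cong: if_cong)

definition hat :: "real \<Rightarrow> real" where "hat s = max 0 (1 - \<bar>s\<bar>)"
definition bump :: "real \<Rightarrow> real" where "bump s = max 0 (s * (1 - s))"

text \<open>On \<open>[j, j + 1]\<close> this is the segment from \<open>a j\<close> to \<open>a (j + 1)\<close>, pushed away from the origin
  in the directions of the coordinates \<open>I j\<close> and \<open>I (j + 1)\<close>, where the endpoints are positive.\<close>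

definition interpolate :: "nat \<Rightarrow> (nat \<Rightarrow> nat) \<Rightarrow> (nat \<Rightarrow> nat \<Rightarrow> real) \<Rightarrow> real \<Rightarrow> nat \<Rightarrow> real" where
  "interpolate k I a q i = (\<Sum>j<k. hat (q - real j) * a j i) +
     (\<Sum>j<k - 1. bump (q - real j) * (3 * (basis_vec (I j) i + basis_vec (I (Suc j)) i)))"

lemma hat_int: "hat (real p - real j) = of_bool (j = p)"
  by (auto simp: hat_def)

lemma bump_int: "bump (real p - real j) = 0"
proof -
  define z where "z = int p - int j"
  have "z * (1 - z) \<le> 0" by (cases "z \<le> 0") (auto simp: mult_nonpos_nonneg mult_nonneg_nonpos)
  moreover have "real p - real j = real_of_int z" by (simp add: z_def)
  ultimately show ?thesis
    unfolding bump_def by (metis max.absorb1 of_int_0_le_iff of_int_1 of_int_diff of_int_le_0_iff of_int_mult)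
qed

lemma interpolate_int: "p < k \<Longrightarrow> interpolate k I a (real p) i = a p i"
  by (simp add: interpolate_def hat_int bump_int of_bool_def if_distrib[of "\<lambda>x. x * _"] cong: if_cong)

lemma segment_sum:
  assumes s: "0 \<le> s" "s \<le> 1" and p: "Suc p < k"
  shows "interpolate k I a (real p + s) i = (1 - s) * a p i + s * a (Suc p) i +
    3 * (s * (1 - s)) * (basis_vec (I p) i + basis_vec (I (Suc p)) i)"
proof -
  have hat0: "hat (real p + s - real j) = 0" if "j \<noteq> p" "j \<noteq> Suc p" for j
    using that s by (auto simp: hat_def)
  have "(\<Sum>j<k. hat (real p + s - real j) * a j i) = (\<Sum>j\<in>{p, Suc p}. hat (real p + s - real j) * a j i)"
    using p hat0 by (intro sum.mono_neutral_right) auto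
  also have "\<dots> = (1 - s) * a p i + s * a (Suc p) i"
    using s by (simp add: hat_def)
  finally have 1: "(\<Sum>j<k. hat (real p + s - real j) * a j i) = (1 - s) * a p i + s * a (Suc p) i" .
  have bump0: "bump (real p + s - real j) = 0" if "j \<noteq> p" for j
  proof (cases "j < p")
    case True
    then have "real p + s - real j \<ge> 1" using s by (auto simp: Suc_le_eq[symmetric])
    then show ?thesis by (simp add: bump_def mult_nonneg_nonpos)
  next
    case False
    then have "real p + s - real j \<le> 0" using s that by auto
    then show ?thesis by (simp add: bump_def mult_nonpos_nonneg)
  qed
  have "(\<Sum>j<k - 1. bump (real p + s - real j) * (3 * (basis_vec (I j) i + basis_vec (I (Suc j)) i))) =
      (\<Sum>j\<in>{p}. bump (real p + s - real j) * (3 * (basis_vec (I j) i + basis_vec (I (Suc j)) i)))"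
    using p bump0 by (intro sum.mono_neutral_right) auto
  also have "\<dots> = 3 * (s * (1 - s)) * (basis_vec (I p) i + basis_vec (I (Suc p)) i)"
    using s by (simp add: bump_def max_def)
  finally show ?thesis using 1 by (simp add: interpolate_def)
qed

text \<open>A plain segment would meet the origin when its ends are antipodal. On each half, the
  push along the coordinate of the nearer end compensates the farther end, whose coordinates are at
  least -1, and the nearer end adds a positive amount.\<close>

lemma interpolate_nonzero:
  assumes k: "k \<ge> 2" and q: "0 \<le> q" "q \<le> real k - 1"
    and pos: "\<And>j. j < k \<Longrightarrow> a j (I j) > 0" and bd: "\<And>j i. j < k \<Longrightarrow> \<bar>a j i\<bar> \<le> 1"
  shows "\<exists>j<k. interpolate k I a q (I j) > 0"
proof -
  \<comment> \<open>The bound \<open>k - 2\<close> assigns the right end \<open>q = k - 1\<close> to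
    the last segment, with \<open>s = 1\<close>.\<close>
  define p where "p = min (nat \<lfloor>q\<rfloor>) (k - 2)"
  define s where "s = q - real p"
  have p: "Suc p < k" using k by (auto simp: p_def)
  have s: "0 \<le> s" "s \<le> 1"
    using q k by (auto simp: s_def p_def min_def of_nat_diff) linarith+
  have seg: "interpolate k I a q i = (1 - s) * a p i + s * a (Suc p) i +
      3 * (s * (1 - s)) * (basis_vec (I p) i + basis_vec (I (Suc p)) i)" for i
    using segment_sum[OF s p, of I a i] by (simp add: s_def)
  have b: "basis_vec i j \<ge> 0" "basis_vec i i = 1" for i j by (auto simp: basis_vec_def)
  have pos': "a p (I p) > 0" "a (Suc p) (I (Suc p)) > 0" using pos p by auto
  have bd': "a (Suc p) (I p) \<ge> -1" "a p (I (Suc p)) \<ge> -1"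
    using bd[of "Suc p" "I p"] bd[of p "I (Suc p)"] p by (auto simp: abs_le_iff)
  \<comment> \<open>The factor 3 of the push suffices because \<open>3 * (1 - s)\<close> is at least
    1 on the first half and \<open>3 * s\<close> on the second.\<close>
  show ?thesis
  proof (cases "s < 1/2")
    case True
    have "3 * (s * (1 - s)) * 1 \<le> 3 * (s * (1 - s)) * (basis_vec (I p) (I p) + basis_vec (I (Suc p)) (I p))"
      using s b by (intro mult_left_mono) auto
    moreover have "s * -1 \<le> s * a (Suc p) (I p)" using s bd' by (intro mult_left_mono) auto
    moreover have "s * 1 \<le> s * (3 * (1 - s))" using s True by (intro mult_left_mono) auto
    moreover have "0 < (1 - s) * a p (I p)" using True pos' by simp
    ultimately have "interpolate k I a q (I p) > 0" unfolding seg by (simp add: algebra_simps)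
    then show ?thesis using p by (intro exI[of _ p]) simp
  next
    case False
    have "3 * (s * (1 - s)) * 1 \<le> 3 * (s * (1 - s)) *
        (basis_vec (I p) (I (Suc p)) + basis_vec (I (Suc p)) (I (Suc p)))"
      using s b by (intro mult_left_mono) auto
    moreover have "(1 - s) * -1 \<le> (1 - s) * a p (I (Suc p))" using s bd' by (intro mult_left_mono) auto
    moreover have "(1 - s) * 1 \<le> (1 - s) * (3 * s)" using s False by (intro mult_left_mono) auto
    moreover have "0 < s * a (Suc p) (I (Suc p))" using False pos' by simp
    ultimately have "interpolate k I a q (I (Suc p)) > 0" unfolding seg by (simp add: algebra_simps)
    then show ?thesis using p by (intro exI[of _ "Suc p"]) simp
  qed
qed

lemma nsphere_coord_le_1:
  assumes "x \<in> topspace (nsphere n)"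
  shows "\<bar>x i\<bar> \<le> 1"
proof (cases "i \<le> n")
  case True
  have "(x i)\<^sup>2 \<le> (\<Sum>i\<le>n. (x i)\<^sup>2)" using True by (intro member_le_sum) auto
  also have "\<dots> = 1" using assms by (simp add: nsphere)
  finally show ?thesis by (simp add: abs_square_le_1)
next
  case False
  then show ?thesis using assms by (simp add: in_nsphere_iff)
qed

text \<open>Each class has a preferred lift, the one with positive coordinate \<open>I j\<close>.
  Consecutive lifts are joined through nonzero vectors, and normalising and projecting these gives a
  path that depends continuously on the tuple.\<close>

lemma admits_section_charts:
  assumes k: "k \<ge> 2" and I: "\<And>j. j < k \<Longrightarrow> I j \<le> n"
    and A: "A \<subseteq> topspace (power_space k (real_projective_space n))"
    and pos: "\<And>x j. x \<in> A \<Longrightarrow> j < k \<Longrightarrow> coord_abs (I j) (x j) > 0"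
  shows "admits_section k (real_projective_space n) A"
proof -
  let ?P = "real_projective_space n"
  let ?X = "subtopology (power_space k ?P) A"
  let ?Z = "prod_topology ?X (top_of_set {0..1::real})"
  define rep where "rep x j = representative n (basis_vec (I j)) (x j)" for x j
  have chart: "x j \<in> chart n (basis_vec (I j))" if "x \<in> A" "j < k" for x j
  proof -
    have "x j \<in> topspace ?P" using A that by (auto simp: power_space_def PiE_iff)
    then obtain y where "y \<in> topspace (nsphere n)" "x j = antipodal_class y"
      by (auto simp: topspace_projective)
    then show ?thesis
      using pos[OF that] I[OF that(2)] by (simp add: antipodal_class_in_chart_iff ip_basis_vec)
  qed
  have rep: "rep x j \<in> topspace (nsphere n)" "antipodal_class (rep x j) = x j" "rep x j (I j) > 0"
    if "x \<in> A" "j < k" for x j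
    using representative[OF chart[OF that]] I[OF that(2)] by (auto simp: rep_def ip_basis_vec)
  have crep: "continuous_map ?X (nsphere n) (\<lambda>x. rep x j)" if j: "j < k" for j
  proof -
    have "continuous_map ?X ?P (\<lambda>x. x j)"
      unfolding power_space_def using j
      by (intro continuous_map_from_subtopology continuous_map_product_projection) simp
    then have "continuous_map ?X (subtopology ?P (chart n (basis_vec (I j)))) (\<lambda>x. x j)"
      using chart j by (auto simp: continuous_map_in_subtopology)
    from continuous_map_compose[OF this continuous_map_representative]
    show ?thesis by (simp add: o_def rep_def)
  qed
  \<comment> \<open>Stretching time by \<open>k - 1\<close> turns the evaluation times into
    integers, where the interpolation returns the representatives.\<close>
  define F where "F z i = interpolate k I (rep (fst z)) ((real k - 1) * snd z) i" for z :: "(nat \<Rightarrow> (nat \<Rightarrow> real) set) \<times> real" and i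
  define G where "G z = (\<lambda>i. F z i / sqrt (ip n (F z) (F z)))" for z
  have F_out: "F z i = 0" if "z \<in> topspace ?Z" "i > n" for z i
  proof -
    have "rep (fst z) j i = 0" if "j < k" for j
      using rep(1)[of "fst z" j] \<open>z \<in> topspace ?Z\<close> \<open>i > n\<close> that by (auto simp: in_nsphere_iff)
    moreover have "basis_vec (I j) i = 0" if "j < k" for j
      using I[OF that] \<open>i > n\<close> by (simp add: basis_vec_def)
    ultimately show ?thesis by (simp add: F_def interpolate_def)
  qed
  have F_pos: "ip n (F z) (F z) > 0" if z: "z \<in> topspace ?Z" for z
  proof -
    have "\<exists>j<k. F z (I j) > 0"
      unfolding F_def
    proof (rule interpolate_nonzero[OF k])
      show "0 \<le> (real k - 1) * snd z" "(real k - 1) * snd z \<le> real k - 1"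
        using z k by (auto intro!: mult_left_le)
      have "fst z \<in> A" using z by auto
      then show "\<And>j. j < k \<Longrightarrow> rep (fst z) j (I j) > 0" "\<And>j i. j < k \<Longrightarrow> \<bar>rep (fst z) j i\<bar> \<le> 1"
        using rep(3) nsphere_coord_le_1[OF rep(1)] by blast+
    qed
    then obtain j where j: "j < k" "F z (I j) > 0" by blast
    have "0 < F z (I j) * F z (I j)" using j by simp
    also have "\<dots> \<le> ip n (F z) (F z)"
      unfolding ip_def using I[OF j(1)] by (intro member_le_sum) auto
    finally show ?thesis .
  qed
  have c_rep: "continuous_map ?Z euclideanreal (\<lambda>z. rep (fst z) j i)" if "j < k" for j i
    using continuous_map_compose[OF continuous_map_fst crep[OF that]]
    by (auto simp: continuous_map_nsphere_iff o_def)
  have c_q: "continuous_map ?Z euclideanreal (\<lambda>z. (real k - 1) * snd z - real j)" for j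
    by (intro continuous_map_diff continuous_map_real_mult continuous_map_into_fulltopology[OF continuous_map_snd]) auto
  have cF: "continuous_map ?Z euclideanreal (\<lambda>z. F z i)" for i
    unfolding F_def interpolate_def hat_def bump_def
    by (intro continuous_map_add continuous_map_sum continuous_map_real_mult continuous_map_real_max
        continuous_map_diff continuous_map_real_abs c_q c_rep continuous_map_const[THEN iffD2]) auto
  have "continuous_map ?Z (nsphere n) G"
    unfolding continuous_map_nsphere_iff
  proof (intro conjI allI)
    fix i
    show "continuous_map ?Z euclideanreal (\<lambda>z. G z i)"
      unfolding G_def using F_pos
      by (intro continuous_map_real_divide continuous_map_sqrt continuous_map_ip cF) (auto simp: less_le)
  next
    have "G z \<in> topspace (nsphere n)" if z: "z \<in> topspace ?Z" for z
    proof -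
      have "ip n (G z) (G z) = ip n (F z) (F z) / (sqrt (ip n (F z) (F z)))\<^sup>2"
        by (simp add: ip_def G_def sum_divide_distrib power2_eq_square)
      also have "\<dots> = 1" using F_pos[OF z] by simp
      finally show ?thesis using F_out[OF z] by (simp add: in_nsphere_iff G_def)
    qed
    then show "G \<in> topspace ?Z \<rightarrow> topspace (nsphere n)" by blast
  qed
  from continuous_map_compose[OF this continuous_map_antipodal_class]
  have "continuous_map ?X (path_space ?P) (\<lambda>x. \<lambda>r\<in>{0..1}. (antipodal_class \<circ> G) (x, r))"
    by (rule continuous_map_curry_path)
  moreover have "path_eval k (\<lambda>r\<in>{0..1}. (antipodal_class \<circ> G) (x, r)) = x" if x: "x \<in> A" for x
  proof
    fix j
    show "path_eval k (\<lambda>r\<in>{0..1}. (antipodal_class \<circ> G) (x, r)) j = x j"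
    proof (cases "j < k")
      case True
      have r: "real j / (real k - 1) \<in> {0..1}" using True k by (auto simp: divide_le_eq)
      have F: "F (x, real j / (real k - 1)) = rep x j"
        using k interpolate_int[OF True] by (auto simp: F_def fun_eq_iff)
      have "G (x, real j / (real k - 1)) = rep x j"
        using rep(1)[OF x True] unfolding G_def F by (simp add: in_nsphere_iff)
      then show ?thesis using True r rep(2)[OF x True] by (simp add: path_eval_def)
    next
      case False
      then show ?thesis using A x by (auto simp: path_eval_def power_space_def PiE_iff extensional_def)
    qed
  qed
  ultimately show ?thesis unfolding admits_section_def by blast
qed

section \<open>Separating the product cells of equal dimension\<close>

lemma TC_projective_le:
  assumes k: "k \<ge> 2"
  shows "TC k (real_projective_space n) \<le> enat (k * n)"
proof -
  let ?P = "real_projective_space n"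
  let ?X = "power_space k ?P"
  \<comment> \<open>In the cell of \<open>I\<close>, the first nonzero coordinate of factor
    \<open>j\<close> is number \<open>I j\<close>; so \<open>d\<close> is the codimension of the
    cell.\<close>
  define Idx where "Idx d = {I \<in> {..<k} \<rightarrow>\<^sub>E {..n}. (\<Sum>j<k. I j) = d}" for d
  define h where "h I x = (\<Prod>j<k. coord_abs (I j) (x j))" for I and x :: "nat \<Rightarrow> (nat \<Rightarrow> real) set"
  \<comment> \<open>The region where the monomial of \<open>I\<close> is positive and strictly
    dominates the other monomials of the same weight \<open>d\<close>. Domination makes the regions
    of one weight disjoint, and positivity puts each inside a product of charts.\<close>
  define A where "A d I = {x \<in> topspace ?X. 0 < h I x} \<inter>
    (\<Inter>I'\<in>Idx d - {I}. {x \<in> topspace ?X. 0 < h I x - h I' x}) \<inter> topspace ?X" for d I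
  have fin: "finite (Idx d)" for d
    unfolding Idx_def by (rule finite_subset[OF _ finite_PiE[of "{..<k}" "\<lambda>_. {..n}"]]) auto
  have ch: "continuous_map ?X euclideanreal (h I)" for I
    unfolding h_def
  proof (intro continuous_map_prod)
    fix j assume "j \<in> {..<k}"
    then have "continuous_map ?X ?P (\<lambda>x. x j)"
      unfolding power_space_def by (rule continuous_map_product_projection)
    from continuous_map_compose[OF this continuous_map_coord_abs]
    show "continuous_map ?X euclideanreal (\<lambda>x. coord_abs (I j) (x j))" by (simp add: o_def)
  qed simp
  have open_pos: "openin ?X {x \<in> topspace ?X. 0 < f x}" if "continuous_map ?X euclideanreal f" for f
    using openin_continuous_map_preimage[OF that, of "{0<..}"] by simp
  have h_nonneg: "h I x \<ge> 0" for I x unfolding h_def by (intro prod_nonneg) (auto simp: coord_abs_def)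
  have A_open: "openin ?X (A d I)" for d I
  proof (cases "Idx d - {I} = {}")
    case True
    show ?thesis unfolding A_def True using open_pos[OF ch] by (simp add: openin_Int)
  next
    case False
    have "openin ?X {x \<in> topspace ?X. 0 < h I x - h I' x}" for I'
      by (intro open_pos continuous_map_diff ch)
    then have "openin ?X (\<Inter>I'\<in>Idx d - {I}. {x \<in> topspace ?X. 0 < h I x - h I' x})"
      using False fin by (intro openin_Inter) auto
    then show ?thesis unfolding A_def using open_pos[OF ch] by (intro openin_Int) auto
  qed
  have A_section: "admits_section k ?P (A d I)" if "I \<in> Idx d" for d I
  proof (rule admits_section_charts[OF k])
    show "I j \<le> n" if "j < k" for j using \<open>I \<in> Idx d\<close> that by (auto simp: Idx_def PiE_iff)
    show "A d I \<subseteq> topspace ?X" by (auto simp: A_def)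
    fix x j assume x: "x \<in> A d I" and j: "j < k"
    have "h I x \<noteq> 0" using x by (auto simp: A_def)
    then have "coord_abs (I j) (x j) \<noteq> 0" using j by (auto simp: h_def)
    then show "coord_abs (I j) (x j) > 0" by (simp add: coord_abs_def)
  qed
  have A_disjoint: "A d I \<inter> A d I' = {}" if "I \<in> Idx d" "I' \<in> Idx d" "I \<noteq> I'" for d I I'
  proof -
    have False if "x \<in> A d I" "x \<in> A d I'" for x
    proof -
      have "h I x - h I' x > 0" "h I' x - h I x > 0"
        using that \<open>I \<in> Idx d\<close> \<open>I' \<in> Idx d\<close> \<open>I \<noteq> I'\<close> by (auto simp: A_def)
      then show False by simp
    qed
    then show ?thesis by blast
  qed
  have A_cover: "\<exists>d\<le>k * n. \<exists>I\<in>Idx d. x \<in> A d I" if x: "x \<in> topspace ?X" for x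
  proof -
    define I where "I = (\<lambda>j\<in>{..<k}. LEAST i. coord_abs i (x j) \<noteq> 0)"
    have I: "I j \<le> n \<and> coord_abs (I j) (x j) \<noteq> 0 \<and> (\<forall>i<I j. coord_abs i (x j) = 0)" if j: "j < k" for j
    proof -
      have "x j \<in> topspace ?P" using x j by (auto simp: power_space_def PiE_iff)
      then obtain y where y: "y \<in> topspace (nsphere n)" "x j = antipodal_class y"
        by (auto simp: topspace_projective)
      have "\<exists>i\<le>n. y i \<noteq> 0"
      proof (rule ccontr)
        assume "\<not> ?thesis"
        then have "ip n y y = 0" by (simp add: ip_def)
        then show False using y by (simp add: in_nsphere_iff)
      qed
      then obtain i where i: "i \<le> n" "coord_abs i (x j) \<noteq> 0" using y by auto
      have "I j = (LEAST i. coord_abs i (x j) \<noteq> 0)" using j by (simp add: I_def)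
      then show ?thesis using i LeastI[of "\<lambda>i. coord_abs i (x j) \<noteq> 0"] Least_le[of "\<lambda>i. coord_abs i (x j) \<noteq> 0"]
        not_less_Least[of _ "\<lambda>i. coord_abs i (x j) \<noteq> 0"] by (metis le_trans)
    qed
    define d where "d = (\<Sum>j<k. I j)"
    have "d \<le> (\<Sum>j<k. n)" unfolding d_def using I by (intro sum_mono) auto
    then have d: "d \<le> k * n" by simp
    have "I \<in> extensional {..<k}" by (simp add: I_def)
    then have Id: "I \<in> Idx d" using I by (simp add: Idx_def d_def PiE_iff)
    have "h I x \<noteq> 0" using I by (auto simp: h_def)
    then have hI: "h I x > 0" using h_nonneg[of I x] by simp
    have "h I' x = 0" if I': "I' \<in> Idx d" "I' \<noteq> I" for I'
    proof -
      \<comment> \<open>As both index vectors have sum \<open>d\<close>, one that is nowhere smaller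
        than \<open>I\<close> would equal \<open>I\<close>. A smaller entry points to a coordinate
        before the first nonzero one, which annihilates the monomial of \<open>I'\<close>.\<close>
      have "\<exists>j<k. I' j < I j"
      proof (rule ccontr)
        assume "\<not> ?thesis"
        then have le: "I j \<le> I' j" if "j < k" for j using that by (meson not_le)
        have "(\<Sum>j<k. I j) = (\<Sum>j<k. I' j)" using I'(1) by (simp add: Idx_def d_def)
        then have "I j = I' j" if "j < k" for j
          using le that sum_strict_mono_ex1[of "{..<k}" I I'] by (metis finite_lessThan le_neq_implies_less lessThan_iff nat_neq_iff)
        then have "I = I'"
          using Id I'(1) by (auto simp: Idx_def intro!: PiE_ext[of I "{..<k}" "\<lambda>_. {..n}"])
        then show False using I'(2) by simp
      qed
      then obtain j where "j < k" "coord_abs (I' j) (x j) = 0" using I by blast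
      then show ?thesis by (auto simp: h_def)
    qed
    then have "x \<in> A d I" using x hI by (auto simp: A_def)
    then show ?thesis using d Id by blast
  qed
  define U where "U d = (\<Union>I\<in>Idx d. A d I)" for d
  have "openin ?X (U d) \<and> admits_section k ?P (U d)" for d
    unfolding U_def using A_open A_section A_disjoint
    by (intro conjI openin_Union admits_section_disjoint_Union) auto
  moreover have "(\<Union>d\<le>k * n. U d) = topspace ?X"
  proof
    show "(\<Union>d\<le>k * n. U d) \<subseteq> topspace ?X" by (auto simp: U_def A_def)
    show "topspace ?X \<subseteq> (\<Union>d\<le>k * n. U d)" using A_cover unfolding U_def by blast
  qed
  ultimately have "enat (k * n) \<in> {enat m |m. \<exists>U. (\<forall>i\<le>m. openin ?X (U i) \<and> admits_section k ?P (U i)) \<and>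
      (\<Union>i\<le>m. U i) = topspace ?X}" by blast
  then show ?thesis unfolding TC_def by (rule Inf_lower)
qed

theorem proposition1p4:
  fixes n k :: nat
  assumes "even n" and "k \<ge> 2" and "k \<ge> 2 ^ (longest_ones n + 1) - 1"
  shows "TC k (real_projective_space n) = enat (k * n)"
  using TC_projective_le[OF assms(2)] TC_projective_ge[OF assms] by (rule antisym)

end
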